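(* Let $n\in\mathbb{N}_0$, $\Gamma,\eta>0$ and $\delta>0$. Then there exists an integer $N=N(n,\Gamma,\eta,\delta)$ such that for any linear operator $T: SL^\infty_N\to SL^\infty_N$ with $\|T\|\le\Gamma$ and $$|\langle T h_K, h_K\rangle|\ge \delta|K|,\qquad K\in\mathcal{D}^N,$$ there exist operators $R: SL^\infty_n\to SL^\infty_N$ and $S: SL^\infty_N\to SL^\infty_n$ such that $$S\,T\,R=\mathrm{Id}_{SL^\infty_n}.$$ Moreover, the operators $R$ and $S$ can be chosen in such a way that $\|R\|\,\|S\|\le (1+\eta)/\delta$.
   Context: All spaces are over the real scalars. $\mathcal{D}=\{[(k-1)2^{-m},k2^{-m}) : m\in\mathbb{N}_0,\ 1\le k\le 2^m\}$ is the collection of dyadic intervals in $[0,1)$; $|\cdot|$ is Lebesgue measure; $\mathcal{D}_m=\{I\in\mathcal{D}:|I|=2^{-m}\}$ and $\mathcal{D}^m=\bigcup_{k=0}^m\mathcal{D}_k$. For $I\in\mathcal{D}$ with left half $I_0$ and right half $I_1$, the $L^\infty$-normalized Haar function is $h_I=\chi_{I_0}-\chi_{I_1}$. $SL^\infty$ is the space of all $f=\sum_{I\in\mathcal{D}}a_Ih_I\in L^2$ ($a_I\in\mathbb{R}$) with finite norm $$\|f\|_{SL^\infty}=\Big\|\Big(\sum_{I\in\mathcal{D}}a_I^2h_I^2\Big)^{1/2}\Big\|_{L^\infty}.$$ For $m\in\mathbb{N}_0$, $SL^\infty_m=\mathrm{span}\{h_I:I\in\mathcal{D}^m\}\subset SL^\infty$,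 with the norm of $SL^\infty$. The pairing is $\langle f,g\rangle=\int_0^1 f(x)g(x)\,dx$. "Operator" means bounded linear map between Banach spaces, with $\|\cdot\|$ the operator norm. *)

theory Defs
  imports "HOL-Probability.Probability" "HOL-Probability.Essential_Supremum"
begin

definition dyadic_intervals :: "real set set" where
  "dyadic_intervals =
     {{(real k - 1) / 2 ^ m ..< real k / 2 ^ m} | (m::nat) (k::nat). 1 \<le> k \<and> k \<le> 2 ^ m}"

definition dyadic_level :: "nat \<Rightarrow> real set set" where
  "dyadic_level m = {I \<in> dyadic_intervals. measure lborel I = 1 / 2 ^ m}"

definition dyadic_upto :: "nat \<Rightarrow> real set set" where
  "dyadic_upto m = (\<Union>k\<le>m. dyadic_level k)"

definition left_half :: "real set \<Rightarrow> real set" where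
  "left_half I = {Inf I ..< (Inf I + Sup I) / 2}"

definition right_half :: "real set \<Rightarrow> real set" where
  "right_half I = {(Inf I + Sup I) / 2 ..< Sup I}"

definition haar :: "real set \<Rightarrow> real \<Rightarrow> real" where
  "haar I x = indicat_real (left_half I) x - indicat_real (right_half I) x"

definition pairing :: "(real \<Rightarrow> real) \<Rightarrow> (real \<Rightarrow> real) \<Rightarrow> real" where
  "pairing f g = (LINT x:{0..1}|lborel. f x * g x)"

abbreviation unit_measure :: "real measure" where
  "unit_measure \<equiv> restrict_space lborel {0..<1}"

text \<open>
  The relation says that f is in L2 of the unit interval and that f is the L2-limit of the partial
  Haar sums over the levels up to m. The Haar functions are orthogonal, so this is the same as
  convergence of the unordered series. Families are required to vanish off the dyadic intervals,
  which makes the family belonging to f unique.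
\<close>

definition haar_expansion :: "(real \<Rightarrow> real) \<Rightarrow> (real set \<Rightarrow> real) \<Rightarrow> bool" where
  "haar_expansion f a \<longleftrightarrow>
     f \<in> borel_measurable unit_measure \<and> integrable unit_measure (\<lambda>x. (f x)\<^sup>2) \<and>
     (\<forall>I. I \<notin> dyadic_intervals \<longrightarrow> a I = 0) \<and>
     (\<lambda>m. LINT x|unit_measure. (f x - (\<Sum>I\<in>dyadic_upto m. a I * haar I x))\<^sup>2) \<longlonglongrightarrow> 0"

definition haar_coeffs :: "(real \<Rightarrow> real) \<Rightarrow> real set \<Rightarrow> real" where
  "haar_coeffs f = (THE a. haar_expansion f a)"

text \<open>
  For f in L2 with a Haar expansion the sum below is finite almost everywhere, so the
  convention that a divergent sum is 0 has no influence on the essential supremum.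
\<close>

definition square_function :: "(real \<Rightarrow> real) \<Rightarrow> real \<Rightarrow> real" where
  "square_function f x =
     sqrt (\<Sum>\<^sub>\<infinity>I\<in>dyadic_intervals. (haar_coeffs f I)\<^sup>2 * (haar I x)\<^sup>2)"

definition SL_esssup :: "(real \<Rightarrow> real) \<Rightarrow> ereal" where
  "SL_esssup f = esssup unit_measure (\<lambda>x. ereal (square_function f x))"

definition SL_space :: "(real \<Rightarrow> real) set" where
  "SL_space = {f. (\<exists>a. haar_expansion f a) \<and> SL_esssup f < \<infinity>}"

definition SL_norm :: "(real \<Rightarrow> real) \<Rightarrow> real" where
  "SL_norm f = real_of_ereal (SL_esssup f)"

text \<open>
  The elements of this span are step functions on \<open>[0,1)\<close>, extended by 0. Two of
  them that agree almost everywhere agree everywhere, so it is harmless to work with functions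
  instead of classes.
\<close>

definition SL :: "nat \<Rightarrow> (real \<Rightarrow> real) set" where
  "SL m = {f. \<exists>a. f = (\<lambda>x. \<Sum>I\<in>dyadic_upto m. a I * haar I x)}"

definition is_operator :: "nat \<Rightarrow> nat \<Rightarrow> ((real \<Rightarrow> real) \<Rightarrow> (real \<Rightarrow> real)) \<Rightarrow> bool" where
  "is_operator m n T \<longleftrightarrow>
     T \<in> SL m \<rightarrow> SL n \<and>
     (\<forall>f\<in>SL m. \<forall>g\<in>SL m. T (\<lambda>x. f x + g x) = (\<lambda>x. T f x + T g x)) \<and>
     (\<forall>c. \<forall>f\<in>SL m. T (\<lambda>x. c * f x) = (\<lambda>x. c * T f x)) \<and>
     (\<exists>C. \<forall>f\<in>SL m. SL_norm (T f) \<le> C * SL_norm f)"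

text \<open>
  The supremum is the operator norm from SL m, whichever SL n the values lie in. It is a supremum
  of reals and therefore meaningful only for maps that are bounded, as operators are.
\<close>

definition op_norm :: "nat \<Rightarrow> ((real \<Rightarrow> real) \<Rightarrow> (real \<Rightarrow> real)) \<Rightarrow> real" where
  "op_norm m T = (SUP f\<in>{f \<in> SL m. SL_norm f \<le> 1}. SL_norm (T f))"

end

theory Submission
  imports Defs
begin

text \<open>
  The basis functions \<open>h\<^sub>I\<close> of the small space are replaced by blocks \<open>b\<^sub>I = \<Sum> \<epsilon>\<^sub>K h\<^sub>K\<close>, the sum
  running over all dyadic \<open>K\<close> of a single level \<open>\<kappa>\<^sub>I\<close> inside the support of \<open>b\<^sub>I\<close>; the supports of the
  two children of \<open>I\<close> are the sets \<open>b\<^sub>I = 1\<close> and \<open>b\<^sub>I = -1\<close>. As these supports split every \<open>K\<close> evenly,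
  \<open>h\<^sub>I \<mapsto> b\<^sub>I\<close> preserves norms and averaging against the blocks is a contraction.

  The levels are chosen one after the other. Functions of norm at most 1 can carry coefficients
  \<open>\<plusminus>1/\<surd>m\<close> on all intervals of \<open>m\<close> different levels, so the pairings of the earlier blocks with a level
  sum up to at most a multiple of \<open>\<surd>m\<close> over \<open>m\<close> levels, and some level makes all of them small,
  whatever signs are chosen on it. The signs \<open>\<epsilon>\<^sub>K\<close> are then
  used to make the quadratic form of \<open>T\<close> at \<open>b\<^sub>I\<close> at least as large as its diagonal part. The signs of
  the diagonal entries of \<open>T\<close> are absorbed into a multiplier. The resulting matrix of \<open>T\<close> is a small
  perturbation of a diagonal matrix with entries at least \<open>\<delta>\<close>, and is inverted by a Neumann series.
\<close>

section \<open>Block systems on the dyadic tree\<close>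

text \<open>
  A pair \<open>(k, v)\<close> stands for the dyadic interval \<open>[v/2\<^sup>k, (v + 1)/2\<^sup>k)\<close>, and \<open>path_norm N a w\<close> is the
  value of the square function of \<open>\<Sum> a\<^sub>K h\<^sub>K\<close> on the cell \<open>(Suc N, w)\<close>. The cells are one level finer
  than the last \<open>K\<close> so that the Haar functions, too, are constant on them.
\<close>

definition nodes :: "nat \<Rightarrow> (nat \<times> nat) set" where
  "nodes N = (SIGMA k:{..N}. {..<2 ^ k})"

definition node_length :: "nat \<times> nat \<Rightarrow> real" where
  "node_length K = 1 / 2 ^ fst K"

lemma node_length_pos: "0 < node_length K"
  by (simp add: node_length_def)

definition path_norm :: "nat \<Rightarrow> (nat \<times> nat \<Rightarrow> real) \<Rightarrow> nat \<Rightarrow> real" where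
  "path_norm N a w = L2_set (\<lambda>k. a (k, w div 2 ^ (Suc N - k))) {..N}"

text \<open>Stands for a bound on the \<open>SL_norm\<close> of the Haar sum with coefficients
  \<open>a\<close>. The square function is constant on each cell and every cell has positive
  measure, so the essential supremum is a maximum over finitely many \<open>w\<close>.\<close>

definition norm_le :: "nat \<Rightarrow> (nat \<times> nat \<Rightarrow> real) \<Rightarrow> real \<Rightarrow> bool" where
  "norm_le N a C \<longleftrightarrow> (\<forall>w<2 ^ Suc N. path_norm N a w \<le> C)"

lemma finite_nodes [simp]: "finite (nodes N)"
  by (auto simp: nodes_def)

lemma mem_nodes [simp]: "(k, v) \<in> nodes N \<longleftrightarrow> k \<le> N \<and> v < 2 ^ k"
  by (auto simp: nodes_def)

lemma sum_nodes: "(\<Sum>K\<in>nodes N. f K) = (\<Sum>k\<le>N. \<Sum>v<2 ^ k. f (k, v))"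
  by (simp add: nodes_def sum.Sigma)

section \<open>Sums over cells and cancellation between halves\<close>

lemma sum_div_blocks:
  fixes G :: "nat \<Rightarrow> real"
  assumes "b > 0"
  shows "(\<Sum>w<a * b. G (w div b)) = of_nat b * (\<Sum>v<a. G v)"
proof -
  have "(\<Sum>w<a * b. G (w div b)) = (\<Sum>v<a. \<Sum>w=v * b..<v * b + b. G (w div b))"
    by (rule sum.nat_group [symmetric])
  also have "\<dots> = (\<Sum>v<a. \<Sum>w=v * b..<v * b + b. G v)"
  proof (intro sum.cong refl)
    fix v w assume "w \<in> {v * b..<v * b + b}"
    then have "w div b = v" using assms by (intro div_nat_eqI) (auto simp: mult.commute)
    then show "G (w div b) = G v" by simp
  qed
  finally show ?thesis by (simp add: sum_distrib_left)
qed

lemma sum_leaves_eq_sum_level: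
  fixes G :: "nat \<Rightarrow> real"
  assumes "k \<le> Q"
  shows "(\<Sum>w<2 ^ Q. G (w div 2 ^ (Q - k))) = 2 ^ (Q - k) * (\<Sum>v<2 ^ k. G v)"
proof -
  have "(2::nat) ^ Q = 2 ^ k * 2 ^ (Q - k)" using assms by (simp flip: power_add)
  then show ?thesis using sum_div_blocks [of "2 ^ (Q - k)" G "2 ^ k"] by simp
qed

text \<open>\<open>w div 2 ^ s * 2 ^ s\<close> is the first cell of the dyadic group of
  \<open>2 ^ s\<close> cells around \<open>w\<close>. Below, invariance of \<open>u\<close> under
  this replacement expresses that \<open>u\<close> is constant on such groups.\<close>

lemma div_rep:
  fixes w :: nat
  assumes "s \<le> r"
  shows "(w div 2 ^ s * 2 ^ s) div 2 ^ r = w div 2 ^ r"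
proof -
  obtain d where r: "r = s + d" using assms le_Suc_ex by blast
  show ?thesis unfolding r by (simp add: power_add div_mult2_eq)
qed

text \<open>The value of \<open>\<Sum>\<^sub>v e\<^sub>v h\<^bsub>(k,v)\<^esub>\<close> on the cell \<open>(Q, w)\<close>.\<close>

definition branch_sign :: "nat \<Rightarrow> nat \<Rightarrow> (nat \<Rightarrow> real) \<Rightarrow> nat \<Rightarrow> real" where
  "branch_sign Q k e w = e (w div 2 ^ (Q - k)) * (if even (w div 2 ^ (Q - Suc k)) then 1 else - 1)"

text \<open>On each node of level \<open>k\<close> both \<open>u\<close> and \<open>e\<close> are
  constant, while the last factor of \<open>branch_sign\<close> is 1 on the left half and -1 on the
  right half, so the halves cancel.\<close>

lemma sum_branch_sign_eq_0:
  assumes "k < Q" and u: "\<And>w. u (w div 2 ^ (Q - k) * 2 ^ (Q - k)) = u w"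
  shows "(\<Sum>w<2 ^ Q. u w * branch_sign Q k e w) = 0"
proof -
  \<comment> \<open>The summand as a function of the node of level \<open>Suc k\<close> containing
    the cell; \<open>v div 2\<close> is the parent of that node.\<close>
  define H where "H v = u (v div 2 * 2 ^ (Q - k)) * e (v div 2) * (if even v then 1 else - 1)" for v :: nat
  have Qk: "(2::nat) ^ (Q - k) = 2 ^ (Q - Suc k) * 2"
    using assms(1) by (simp flip: power_Suc2 add: Suc_diff_Suc)
  have *: "u w * branch_sign Q k e w = H (w div 2 ^ (Q - Suc k))" for w
  proof -
    have "w div 2 ^ (Q - Suc k) div 2 = w div 2 ^ (Q - k)"
      unfolding Qk by (simp add: div_mult2_eq)
    then show ?thesis using u [of w] by (simp add: H_def branch_sign_def)
  qed
  have "(\<Sum>v<2 ^ Suc k. H v) = (\<Sum>v<2 ^ k * 2. H v)" by (simp add: mult.commute)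
  also have "\<dots> = (\<Sum>v<2 ^ k. \<Sum>w=v * 2..<v * 2 + 2. H w)"
    by (rule sum.nat_group [symmetric])
  also have "\<dots> = 0"
  proof (rule sum.neutral, rule ballI)
    fix v :: nat
    have "{v * 2..<v * 2 + 2} = {2 * v, Suc (2 * v)}" by auto
    then show "(\<Sum>w=v * 2..<v * 2 + 2. H w) = 0" by (simp add: H_def)
  qed
  finally show ?thesis
    using sum_leaves_eq_sum_level [of "Suc k" Q H] assms(1) by (simp add: *)
qed

text \<open>
  The blocks are indexed by heap position: the root is 1, and \<open>i\<close> has the children \<open>2 * i\<close> and
  \<open>2 * i + 1\<close>. The cell \<open>(Q, w)\<close> lies in the support of block \<open>i\<close> iff the values of the ancestor
  blocks on it lead to \<open>i\<close>.
\<close>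

fun block_supp :: "nat \<Rightarrow> (nat \<Rightarrow> nat) \<Rightarrow> (nat \<Rightarrow> nat \<Rightarrow> real) \<Rightarrow> nat \<Rightarrow> nat \<Rightarrow> bool" where
  "block_supp Q \<kappa> \<epsilon> i w = (if i \<le> 1 then True else
     block_supp Q \<kappa> \<epsilon> (i div 2) w \<and>
     branch_sign Q (\<kappa> (i div 2)) (\<epsilon> (i div 2)) w = (if even i then 1 else - 1))"

declare block_supp.simps [simp del]

text \<open>Only the first cell of the node is tested. When the ancestor blocks have levels below
  \<open>\<kappa> i\<close>, the support is a union of nodes of level \<open>\<kappa> i\<close>, and
  one cell decides for the whole node.\<close>

definition block_set :: "nat \<Rightarrow> (nat \<Rightarrow> nat) \<Rightarrow> (nat \<Rightarrow> nat \<Rightarrow> real) \<Rightarrow> nat \<Rightarrow> nat set" where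
  "block_set Q \<kappa> \<epsilon> i = {v. v < 2 ^ \<kappa> i \<and> block_supp Q \<kappa> \<epsilon> i (v * 2 ^ (Q - \<kappa> i))}"

definition block :: "nat \<Rightarrow> (nat \<Rightarrow> nat) \<Rightarrow> (nat \<Rightarrow> nat \<Rightarrow> real) \<Rightarrow> nat \<Rightarrow> nat \<times> nat \<Rightarrow> real" where
  "block Q \<kappa> \<epsilon> i K = (if fst K = \<kappa> i \<and> snd K \<in> block_set Q \<kappa> \<epsilon> i then \<epsilon> i (snd K) else 0)"

lemma finite_block_set [simp]: "finite (block_set Q \<kappa> \<epsilon> i)"
  by (simp add: block_set_def)

text \<open>The recursion only visits proper ancestors, which have smaller heap positions. This
  allows levels and signs to be fixed one block after the other without disturbing earlier
  supports.\<close>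

lemma block_supp_cong:
  assumes "\<And>j. j < i \<Longrightarrow> \<kappa> j = \<kappa>' j" "\<And>j. j < i \<Longrightarrow> \<epsilon> j = \<epsilon>' j"
  shows "block_supp Q \<kappa> \<epsilon> i w = block_supp Q \<kappa>' \<epsilon>' i w"
  using assms
proof (induction i rule: less_induct)
  case (less i)
  show ?case
  proof (cases "i \<le> 1")
    case False
    then have "i div 2 < i" by simp
    then show ?thesis
      using less.IH [of "i div 2"] less.prems
      by (subst (1 2) block_supp.simps) simp
  qed (simp add: block_supp.simps)
qed

lemma block_set_cong:
  assumes "\<And>j. j < i \<Longrightarrow> \<kappa> j = \<kappa>' j" "\<And>j. j < i \<Longrightarrow> \<epsilon> j = \<epsilon>' j" "\<kappa> i = \<kappa>' i"
  shows "block_set Q \<kappa> \<epsilon> i = block_set Q \<kappa>' \<epsilon>' i"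
  using block_supp_cong [OF assms(1,2)] assms(3) by (simp add: block_set_def)

lemma block_cong:
  assumes "\<And>j. j \<le> i \<Longrightarrow> \<kappa> j = \<kappa>' j" "\<And>j. j \<le> i \<Longrightarrow> \<epsilon> j = \<epsilon>' j"
  shows "block Q \<kappa> \<epsilon> i = block Q \<kappa>' \<epsilon>' i"
  using block_set_cong [of i \<kappa> \<kappa>' \<epsilon> \<epsilon>' Q] assms by (simp add: block_def fun_eq_iff)

text \<open>An ancestor of level below \<open>k\<close> has a sign that depends only on a half of
  one of its nodes, hence is constant on nodes of level \<open>k\<close>.\<close>

lemma block_supp_rep:
  assumes "\<And>p. 1 \<le> p \<Longrightarrow> p < i \<Longrightarrow> \<kappa> p < k" "k \<le> Q"
  shows "block_supp Q \<kappa> \<epsilon> i (w div 2 ^ (Q - k) * 2 ^ (Q - k)) = block_supp Q \<kappa> \<epsilon> i w"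
  using assms
proof (induction i rule: less_induct)
  case (less i)
  show ?case
  proof (cases "i \<le> 1")
    case False
    then have i: "i div 2 < i" "1 \<le> i div 2" by simp_all
    then have k: "\<kappa> (i div 2) < k" using less.prems by blast
    then have "branch_sign Q (\<kappa> (i div 2)) e (w div 2 ^ (Q - k) * 2 ^ (Q - k)) =
        branch_sign Q (\<kappa> (i div 2)) e w" for e
      by (simp add: branch_sign_def div_rep)
    moreover have "block_supp Q \<kappa> \<epsilon> (i div 2) (w div 2 ^ (Q - k) * 2 ^ (Q - k)) =
        block_supp Q \<kappa> \<epsilon> (i div 2) w"
      using less.prems i by (intro less.IH) auto
    ultimately show ?thesis by (subst (1 2) block_supp.simps) simp
  qed (simp add: block_supp.simps)
qed

lemma sum_block:
  assumes "\<kappa> i \<le> N"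
  shows "(\<Sum>K\<in>nodes N. block Q \<kappa> \<epsilon> i K * G K) = (\<Sum>v\<in>block_set Q \<kappa> \<epsilon> i. \<epsilon> i v * G (\<kappa> i, v))"
proof -
  let ?B = "block_set Q \<kappa> \<epsilon> i"
  have "(\<Sum>K\<in>nodes N. block Q \<kappa> \<epsilon> i K * G K) = (\<Sum>K\<in>Pair (\<kappa> i) ` ?B. block Q \<kappa> \<epsilon> i K * G K)"
    using assms by (intro sum.mono_neutral_right) (auto simp: block_def block_set_def)
  also have "\<dots> = (\<Sum>v\<in>?B. \<epsilon> i v * G (\<kappa> i, v))"
    by (subst sum.reindex) (auto simp: block_def inj_on_def intro!: sum.cong)
  finally show ?thesis .
qed

lemma exists_heap_level:
  fixes i :: nat
  assumes "i \<in> {1..<2 ^ Suc n}"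
  obtains t where "t \<le> n" "i \<in> {2 ^ t..<2 ^ Suc t}"
proof -
  obtain t where t: "2 ^ t \<le> i" "i < 2 ^ (t + 1)"
    using ex_power_ivl1 [of 2 i] assms by auto
  have "(2::nat) ^ t < 2 ^ Suc n" using t assms by simp
  then have "t \<le> n" using power_less_imp_less_exp [of "2::nat" t "Suc n"] by simp
  then show ?thesis using that t by simp
qed

lemma ancestor_level:
  fixes J :: nat
  assumes "J \<in> {2 ^ n..<2 ^ Suc n}" "k \<le> n"
  shows "J div 2 ^ (n - k) \<in> {2 ^ k..<2 ^ Suc k}"
proof -
  have "(2::nat) ^ n = 2 ^ k * 2 ^ (n - k)" using assms(2) by (simp flip: power_add)
  moreover have "(2::nat) ^ Suc n = 2 ^ Suc k * 2 ^ (n - k)" using calculation by simp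
  ultimately show ?thesis using assms(1)
    by (auto simp: less_eq_div_iff_mult_less_eq intro!: less_mult_imp_div_less)
qed

lemma norm_le_cong:
  assumes "\<And>K. K \<in> nodes N \<Longrightarrow> a K = b K"
  shows "norm_le N a C \<longleftrightarrow> norm_le N b C"
proof -
  have "path_norm N a w = path_norm N b w" if w: "w < 2 ^ Suc N" for w
    unfolding path_norm_def
  proof (rule L2_set_cong [OF refl])
    fix k assume k: "k \<in> {..N}"
    then have "(2::nat) ^ Suc N = 2 ^ k * 2 ^ (Suc N - k)" by (simp flip: power_add del: power_Suc)
    then have "w div 2 ^ (Suc N - k) < 2 ^ k" using w by (intro less_mult_imp_div_less) simp
    then show "a (k, w div 2 ^ (Suc N - k)) = b (k, w div 2 ^ (Suc N - k))"
      using k by (intro assms) simp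
  qed
  then show ?thesis by (simp add: norm_le_def)
qed

text \<open>The blocks are those with positions from 1 to \<open>M - 1\<close>. Levels increase
  strictly with the position, not only along branches, so that no two blocks share a level and each
  coefficient of a sum of blocks comes from one block.\<close>

locale block_tree =
  fixes N M :: nat and \<kappa> :: "nat \<Rightarrow> nat" and \<epsilon> :: "nat \<Rightarrow> nat \<Rightarrow> real"
  assumes \<kappa>_mono: "\<And>i j. 1 \<le> i \<Longrightarrow> i < j \<Longrightarrow> j < M \<Longrightarrow> \<kappa> i < \<kappa> j"
    and \<kappa>_le: "\<And>i. 1 \<le> i \<Longrightarrow> i < M \<Longrightarrow> \<kappa> i \<le> N"
    and \<epsilon>_sign: "\<And>i v. \<bar>\<epsilon> i v\<bar> = 1"
begin

abbreviation "Q \<equiv> Suc N"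
abbreviation "X \<equiv> block_supp Q \<kappa> \<epsilon>"
abbreviation "B \<equiv> block_set Q \<kappa> \<epsilon>"
abbreviation "b \<equiv> block Q \<kappa> \<epsilon>"

section \<open>Supports and their measures\<close>

definition supp_sum :: "nat \<Rightarrow> (nat \<Rightarrow> real) \<Rightarrow> real" where
  "supp_sum i u = (\<Sum>w<2 ^ Q. of_bool (X i w) * u w)"

text \<open>The Lebesgue measure of the support of block \<open>i\<close>, computed as the
  proportion of cells in it.\<close>

definition mass :: "nat \<Rightarrow> real" where
  "mass i = supp_sum i (\<lambda>w. 1) / 2 ^ Q"

lemma \<epsilon>_sq [simp]: "(\<epsilon> i v)\<^sup>2 = 1"
  using \<epsilon>_sign [of i v] by (simp add: abs_square_eq_1)

lemma X_rep:
  assumes "1 \<le> i" "i < M" "\<kappa> i \<le> k" "k \<le> Q"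
  shows "X i (w div 2 ^ (Q - k) * 2 ^ (Q - k)) = X i w"
  using assms by (intro block_supp_rep) (auto intro: less_le_trans [OF \<kappa>_mono])

lemma X_div_mem_B:
  assumes "1 \<le> i" "i < M" "w < 2 ^ Q"
  shows "w div 2 ^ (Q - \<kappa> i) \<in> B i \<longleftrightarrow> X i w"
proof -
  have k: "\<kappa> i \<le> N" using \<kappa>_le assms by blast
  have "(2::nat) ^ Q = 2 ^ \<kappa> i * 2 ^ (Q - \<kappa> i)" using k by (simp flip: power_add)
  then have "w div 2 ^ (Q - \<kappa> i) < 2 ^ \<kappa> i"
    using assms by (simp add: less_mult_imp_div_less)
  then show ?thesis using X_rep [of i "\<kappa> i" w] assms k by (simp add: block_set_def)
qed

lemma sum_B:
  assumes "1 \<le> i" "i < M"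
  shows "(\<Sum>v\<in>B i. F v) / 2 ^ \<kappa> i = supp_sum i (\<lambda>w. F (w div 2 ^ (Q - \<kappa> i))) / 2 ^ Q"
proof -
  have k: "\<kappa> i \<le> N" using \<kappa>_le assms by blast
  have "supp_sum i (\<lambda>w. F (w div 2 ^ (Q - \<kappa> i))) =
      (\<Sum>w<2 ^ Q. (\<lambda>v. of_bool (v \<in> B i) * F v) (w div 2 ^ (Q - \<kappa> i)))"
    unfolding supp_sum_def using X_div_mem_B assms by (intro sum.cong) auto
  also have "\<dots> = 2 ^ (Q - \<kappa> i) * (\<Sum>v<2 ^ \<kappa> i. of_bool (v \<in> B i) * F v)"
    using k by (intro sum_leaves_eq_sum_level) simp
  also have "(\<Sum>v<2 ^ \<kappa> i. of_bool (v \<in> B i) * F v) = (\<Sum>v\<in>B i. F v)"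
    by (rule sum.mono_neutral_cong_right) (auto simp: block_set_def)
  finally have "supp_sum i (\<lambda>w. F (w div 2 ^ (Q - \<kappa> i))) = 2 ^ (Q - \<kappa> i) * (\<Sum>v\<in>B i. F v)" .
  moreover have "(2::real) ^ Q = 2 ^ \<kappa> i * 2 ^ (Q - \<kappa> i)" using k by (simp flip: power_add)
  ultimately show ?thesis by (simp add: field_simps)
qed

lemma card_B:
  assumes "1 \<le> i" "i < M"
  shows "of_nat (card (B i)) / 2 ^ \<kappa> i = mass i"
  using sum_B [OF assms, of "\<lambda>v. 1"] by (simp add: mass_def)

lemma branch_sign_cases: "branch_sign Q k (\<epsilon> j) w = 1 \<or> branch_sign Q k (\<epsilon> j) w = - 1"
  using \<epsilon>_sign [of j "w div 2 ^ (Q - k)"] by (auto simp: branch_sign_def abs_if split: if_splits)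

text \<open>The sign of the parent block splits each node of the parent's level evenly, so a
  function constant on those nodes has the same sum over both children.\<close>

lemma supp_sum_child:
  assumes "2 \<le> i" "i < M" and u: "\<And>w. u (w div 2 ^ (Q - \<kappa> (i div 2)) * 2 ^ (Q - \<kappa> (i div 2))) = u w"
  shows "supp_sum i u = supp_sum (i div 2) u / 2"
proof -
  let ?p = "i div 2"
  let ?s = "if even i then 1 else - 1 :: real"
  have p: "1 \<le> ?p" "?p < M" using assms by auto
  have k: "\<kappa> ?p < Q" using \<kappa>_le [OF p] by simp
  have X: "X i w \<longleftrightarrow> X ?p w \<and> branch_sign Q (\<kappa> ?p) (\<epsilon> ?p) w = ?s" for w
    using assms(1) by (subst block_supp.simps) simp
  \<comment> \<open>The indicator of a child is that of the parent times
    \<open>(1 + ?s * sign) / 2\<close>; the part carrying the sign sums to 0.\<close>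
  have "of_bool (X i w) * u w =
      (of_bool (X ?p w) * u w) / 2 + ?s / 2 * ((of_bool (X ?p w) * u w) * branch_sign Q (\<kappa> ?p) (\<epsilon> ?p) w)" for w
    unfolding X using branch_sign_cases [of "\<kappa> ?p" ?p w] by (auto simp: field_simps)
  then have "supp_sum i u = supp_sum ?p u / 2 +
      ?s / 2 * (\<Sum>w<2 ^ Q. (of_bool (X ?p w) * u w) * branch_sign Q (\<kappa> ?p) (\<epsilon> ?p) w)"
    by (simp only: supp_sum_def sum.distrib sum_distrib_left sum_divide_distrib)
  also have "(\<Sum>w<2 ^ Q. (of_bool (X ?p w) * u w) * branch_sign Q (\<kappa> ?p) (\<epsilon> ?p) w) = 0"
    using k X_rep [OF p, of "\<kappa> ?p"] u by (intro sum_branch_sign_eq_0) auto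
  finally show ?thesis by simp
qed

lemma supp_sum_descendant:
  assumes "1 \<le> J div 2 ^ t" "J < M"
    and u: "\<And>w. u (w div 2 ^ (Q - \<kappa> (J div 2 ^ t)) * 2 ^ (Q - \<kappa> (J div 2 ^ t))) = u w"
  shows "supp_sum J u = supp_sum (J div 2 ^ t) u / 2 ^ t"
  using assms
proof (induction t arbitrary: J)
  case (Suc t)
  let ?i = "J div 2 ^ Suc t"
  have i: "?i = (J div 2) div 2 ^ t" by (simp add: div_mult2_eq)
  have ge: "?i \<le> J div 2" unfolding i by simp
  have J: "2 \<le> J"
  proof (rule ccontr)
    assume "\<not> 2 \<le> J"
    then have "J div 2 = 0" by auto
    then show False using Suc.prems(1) i by simp
  qed
  have lt: "J div 2 < M" using Suc.prems(2) by auto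
  have le: "\<kappa> ?i \<le> \<kappa> (J div 2)"
  proof (cases "?i = J div 2")
    case False
    then show ?thesis using ge Suc.prems(1) lt \<kappa>_mono [of ?i "J div 2"] by linarith
  qed simp
  \<comment> \<open>Constancy on nodes of the ancestor's level passes to the finer nodes of the
    level of \<open>J div 2\<close>: both cells have the same coarse representative by
    \<open>div_rep\<close>.\<close>
  have "u (w div 2 ^ (Q - \<kappa> (J div 2)) * 2 ^ (Q - \<kappa> (J div 2))) = u w" for w
    using Suc.prems(3) [of w] Suc.prems(3) [of "w div 2 ^ (Q - \<kappa> (J div 2)) * 2 ^ (Q - \<kappa> (J div 2))"] le
    by (simp add: div_rep diff_le_mono2)
  then have "supp_sum J u = supp_sum (J div 2) u / 2"
    using J Suc.prems by (intro supp_sum_child) auto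
  also have "supp_sum (J div 2) u = supp_sum ((J div 2) div 2 ^ t) u / 2 ^ t"
    using Suc.prems lt unfolding i by (intro Suc.IH) auto
  finally show ?case unfolding i by simp
qed simp

lemma mass_descendant:
  assumes "1 \<le> J div 2 ^ t" "J < M"
  shows "mass J = mass (J div 2 ^ t) / 2 ^ t"
  using supp_sum_descendant [OF assms, of "\<lambda>w. 1"] by (simp add: mass_def)

text \<open>Each step down the heap halves the support, starting from the whole interval. A support
  is thus as large as the dyadic interval whose Haar function the block replaces.\<close>

lemma mass_level:
  assumes "J \<in> {2 ^ t..<2 ^ Suc t}" "J < M"
  shows "mass J = 1 / 2 ^ t"
proof -
  have "J div 2 ^ t = 1" using assms by (intro div_nat_eqI) auto
  moreover have "mass 1 = 1" by (simp add: mass_def supp_sum_def block_supp.simps)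
  ultimately show ?thesis using mass_descendant [of J t] assms by simp
qed

lemma mass_pos:
  assumes "1 \<le> i" "i < M"
  shows "mass i > 0"
proof -
  obtain t where "2 ^ t \<le> i" "i < 2 ^ (t + 1)"
    using ex_power_ivl1 [of 2 i] assms by auto
  then have "mass i = 1 / 2 ^ t" using assms by (intro mass_level) auto
  then show ?thesis by simp
qed

section \<open>Averaging against the blocks\<close>

definition average :: "(nat \<times> nat \<Rightarrow> real) \<Rightarrow> nat \<Rightarrow> real" where
  "average g i = (\<Sum>K\<in>nodes N. b i K * (g K * node_length K)) / mass i"

text \<open>Cauchy-Schwarz against the signs of the block, whose squares sum to
  \<open>card (B i)\<close>. After division by \<open>2 ^ \<kappa> i\<close> this cardinality is
  \<open>mass i\<close> and cancels one of the two factors \<open>mass i\<close> below.\<close>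

lemma average_sq_le:
  assumes "1 \<le> i" "i < M"
  shows "(average g i)\<^sup>2 \<le> supp_sum i (\<lambda>w. (g (\<kappa> i, w div 2 ^ (Q - \<kappa> i)))\<^sup>2) / 2 ^ Q / mass i"
proof -
  let ?l = "1 / 2 ^ \<kappa> i :: real"
  have "(\<Sum>K\<in>nodes N. b i K * (g K * node_length K)) = (\<Sum>v\<in>B i. \<epsilon> i v * (g (\<kappa> i, v) * ?l))"
    using \<kappa>_le [OF assms] by (subst sum_block) (simp_all add: node_length_def)
  also have "\<dots> = ?l * (\<Sum>v\<in>B i. \<epsilon> i v * g (\<kappa> i, v))"
    by (simp add: sum_distrib_left mult_ac)
  finally have avg: "average g i = ?l * (\<Sum>v\<in>B i. \<epsilon> i v * g (\<kappa> i, v)) / mass i"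
    by (simp add: average_def)
  have "(\<Sum>v\<in>B i. \<epsilon> i v * g (\<kappa> i, v))\<^sup>2 \<le> (\<Sum>v\<in>B i. (\<epsilon> i v)\<^sup>2) * (\<Sum>v\<in>B i. (g (\<kappa> i, v))\<^sup>2)"
    by (rule Cauchy_Schwarz_ineq_sum)
  then have "(?l)\<^sup>2 * (\<Sum>v\<in>B i. \<epsilon> i v * g (\<kappa> i, v))\<^sup>2 / (mass i)\<^sup>2 \<le>
      (?l)\<^sup>2 * (card (B i) * (\<Sum>v\<in>B i. (g (\<kappa> i, v))\<^sup>2)) / (mass i)\<^sup>2"
    by (intro divide_right_mono mult_left_mono) simp_all
  also have "\<dots> = (card (B i) / 2 ^ \<kappa> i) * ((\<Sum>v\<in>B i. (g (\<kappa> i, v))\<^sup>2) / 2 ^ \<kappa> i) / (mass i)\<^sup>2"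
    by (simp add: power2_eq_square)
  also have "\<dots> = (\<Sum>v\<in>B i. (g (\<kappa> i, v))\<^sup>2) / 2 ^ \<kappa> i / mass i"
    using mass_pos [OF assms] by (simp add: card_B [OF assms] power2_eq_square)
  also have "\<dots> = supp_sum i (\<lambda>w. (g (\<kappa> i, w div 2 ^ (Q - \<kappa> i)))\<^sup>2) / 2 ^ Q / mass i"
    using sum_B [OF assms, of "\<lambda>v. (g (\<kappa> i, v))\<^sup>2"] by simp
  finally show ?thesis by (simp add: avg power_mult_distrib power_divide)
qed

lemma average_sq_le_descendant:
  assumes "1 \<le> J div 2 ^ t" "J < M"
  defines "i \<equiv> J div 2 ^ t"
  shows "(average g i)\<^sup>2 \<le> supp_sum J (\<lambda>w. (g (\<kappa> i, w div 2 ^ (Q - \<kappa> i)))\<^sup>2) / 2 ^ Q / mass J"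
proof -
  have i: "1 \<le> i" "i < M" using assms by (auto intro: le_less_trans [OF div_le_dividend])
  have "supp_sum J (\<lambda>w. (g (\<kappa> i, w div 2 ^ (Q - \<kappa> i)))\<^sup>2) =
      supp_sum i (\<lambda>w. (g (\<kappa> i, w div 2 ^ (Q - \<kappa> i)))\<^sup>2) / 2 ^ t"
    unfolding i_def using assms by (intro supp_sum_descendant) (auto simp: div_rep)
  then show ?thesis
    using average_sq_le [OF i, of g] mass_descendant [OF assms(1,2)]
    by (simp add: i_def)
qed

text \<open>
  By Cauchy-Schwarz a squared average is at most an average of squares over the support of the block,
  and this equals the average over the support of any descendant, in particular over that of \<open>J\<close>.
\<close>

lemma average_path_le:
  assumes J: "J \<in> {2 ^ n..<2 ^ Suc n}" "J < M" and "C \<ge> 0" and g: "norm_le N g C"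
  shows "L2_set (\<lambda>k. average g (J div 2 ^ (n - k))) {..n} \<le> C"
proof -
  let ?i = "\<lambda>k. J div 2 ^ (n - k)"
  let ?G = "\<lambda>k w. (g (\<kappa> (?i k), w div 2 ^ (Q - \<kappa> (?i k))))\<^sup>2"
  have i: "2 ^ k \<le> ?i k" "?i k < 2 ^ Suc k" if "k \<le> n" for k
    using ancestor_level [OF J(1) that] by auto
  have iM: "1 \<le> ?i k" "?i k < M" if "k \<le> n" for k
  proof -
    show "1 \<le> ?i k" using i(1) [OF that] by (meson le_trans one_le_power one_le_numeral)
    show "?i k < M" using J(2) div_le_dividend le_less_trans by blast
  qed
  \<comment> \<open>Heap positions grow strictly along the path to \<open>J\<close>, hence so do the
    levels of the blocks on it.\<close>
  have \<kappa>_strict: "\<kappa> (?i k) < \<kappa> (?i l)" if "k < l" "l \<le> n" for k l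
  proof (rule \<kappa>_mono)
    have "?i k < 2 ^ Suc k" using i that by simp
    also have "\<dots> \<le> 2 ^ l" using that by (intro power_increasing) auto
    also have "\<dots> \<le> ?i l" using i that by simp
    finally show "?i k < ?i l" .
  qed (use iM that in auto)
  have inj: "inj_on (\<lambda>k. \<kappa> (?i k)) {..n}"
    by (rule linorder_inj_onI') (use \<kappa>_strict in force)
  have J1: "1 \<le> J" using iM [of n] by simp
  have "(\<Sum>k\<le>n. (average g (?i k))\<^sup>2) \<le> (\<Sum>k\<le>n. supp_sum J (?G k) / 2 ^ Q / mass J)"
    using iM J(2) by (intro sum_mono average_sq_le_descendant) auto
  also have "\<dots> = supp_sum J (\<lambda>w. \<Sum>k\<le>n. ?G k w) / 2 ^ Q / mass J"
    unfolding supp_sum_def sum_divide_distrib sum_distrib_left by (rule sum.swap)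
  also have "\<dots> \<le> supp_sum J (\<lambda>w. C\<^sup>2) / 2 ^ Q / mass J"
  proof (intro divide_right_mono)
    show "supp_sum J (\<lambda>w. \<Sum>k\<le>n. ?G k w) \<le> supp_sum J (\<lambda>w. C\<^sup>2)"
      unfolding supp_sum_def
    proof (intro sum_mono mult_left_mono)
      fix w assume w: "w \<in> {..<(2::nat) ^ Q}"
      \<comment> \<open>Since these levels are distinct and at most \<open>N\<close>, the sum is a
        part of the squared path norm of \<open>g\<close> on the cell \<open>w\<close>.\<close>
      have "(\<Sum>k\<le>n. ?G k w) = (\<Sum>l\<in>(\<lambda>k. \<kappa> (?i k)) ` {..n}. (g (l, w div 2 ^ (Q - l)))\<^sup>2)"
        by (subst sum.reindex [OF inj]) simp
      also have "\<dots> \<le> (\<Sum>l\<le>N. (g (l, w div 2 ^ (Q - l)))\<^sup>2)"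
        using \<kappa>_le iM by (intro sum_mono2) auto
      also have "\<dots> = (path_norm N g w)\<^sup>2"
        by (simp add: path_norm_def L2_set_def sum_nonneg)
      also have "\<dots> \<le> C\<^sup>2"
        using g w by (intro power_mono) (auto simp: norm_le_def path_norm_def L2_set_nonneg)
      finally show "(\<Sum>k\<le>n. ?G k w) \<le> C\<^sup>2" .
    qed simp
  qed (use mass_pos [OF J1 J(2)] in auto)
  also have "\<dots> = C\<^sup>2"
  proof -
    have "supp_sum J (\<lambda>w. C\<^sup>2) = supp_sum J (\<lambda>w. 1) * C\<^sup>2"
      by (simp add: supp_sum_def sum_distrib_right)
    then show ?thesis
      using mass_pos [OF J1 J(2)] by (simp add: mass_def field_simps)
  qed
  finally show ?thesis
    using assms(3) by (simp add: L2_set_def real_le_lsqrt)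
qed

section \<open>Embedding by blocks\<close>

primrec branch :: "nat \<Rightarrow> nat \<Rightarrow> nat" where
  "branch w 0 = 1"
| "branch w (Suc t) = 2 * branch w t +
     (if branch_sign Q (\<kappa> (branch w t)) (\<epsilon> (branch w t)) w = 1 then 0 else 1)"

lemma branch_level: "branch w t \<in> {2 ^ t..<2 ^ Suc t}"
  by (induction t) auto

lemma branch_div: "k \<le> t \<Longrightarrow> branch w t div 2 ^ (t - k) = branch w k"
proof (induction t)
  case (Suc t)
  show ?case
  proof (cases "k = Suc t")
    case False
    then have "branch w (Suc t) div 2 ^ (Suc t - k) = branch w (Suc t) div 2 div 2 ^ (t - k)"
      using Suc.prems by (simp add: Suc_diff_le div_mult2_eq)
    also have "branch w (Suc t) div 2 = branch w t" by simp
    finally show ?thesis using Suc.IH Suc.prems False by simp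
  qed simp
qed simp

text \<open>A cell of a support has sign 1 or -1 and so belongs to exactly one of the two children.
  The supports of each heap level therefore partition the cells, and \<open>branch w t\<close> names
  the part that contains \<open>w\<close>.\<close>

lemma X_iff_branch:
  assumes "i \<in> {2 ^ t..<2 ^ Suc t}"
  shows "X i w \<longleftrightarrow> i = branch w t"
  using assms
proof (induction t arbitrary: i)
  case 0
  then show ?case by (simp add: block_supp.simps)
next
  case (Suc t)
  let ?p = "i div 2"
  have p: "?p \<in> {2 ^ t..<2 ^ Suc t}" using Suc.prems by auto
  have "(1::nat) \<le> 2 ^ t" by simp
  then have "1 \<le> ?p" using p by (simp only: atLeastLessThan_iff) linarith
  then have "\<not> i \<le> 1" by linarith
  then have "X i w \<longleftrightarrow> X ?p w \<and> branch_sign Q (\<kappa> ?p) (\<epsilon> ?p) w = (if even i then 1 else - 1)"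
    by (subst block_supp.simps) simp
  also have "\<dots> \<longleftrightarrow> i = branch w (Suc t)"
    unfolding Suc.IH [OF p] using branch_sign_cases [of "\<kappa> ?p" ?p w]
    by (auto elim!: evenE oddE; presburger)
  finally show ?case .
qed

definition embed :: "(nat \<Rightarrow> real) \<Rightarrow> nat \<times> nat \<Rightarrow> real" where
  "embed \<alpha> K = (\<Sum>i\<in>{1..<M}. \<alpha> i * b i K)"

text \<open>Exactly the blocks on the branch of \<open>w\<close> contain \<open>w\<close> in their
  supports. They live on distinct levels with coefficients 1 or -1, so the square function at
  \<open>w\<close> equals that of \<open>\<alpha>\<close> along the branch.\<close>

lemma path_norm_embed:
  assumes M: "M = 2 ^ Suc n" and w: "w < 2 ^ Q"
  shows "path_norm N (embed \<alpha>) w = L2_set (\<lambda>k. \<alpha> (branch w n div 2 ^ (n - k))) {..n}"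
proof -
  have br: "branch w k \<in> {1..<M}" if "k \<le> n" for k
  proof -
    have "(2::nat) ^ Suc k \<le> M" using that M by (simp add: power_increasing)
    moreover have "(1::nat) \<le> 2 ^ k" by simp
    ultimately show ?thesis using branch_level [of w k] by (auto simp del: one_le_power one_le_numeral)
  qed
  have inj_\<kappa>: "inj_on \<kappa> {1..<M}"
    by (rule linorder_inj_onI') (use \<kappa>_mono in force)
  have inj_b: "inj_on (branch w) {..n}"
  proof (rule linorder_inj_onI')
    fix k l :: nat assume "k < l"
    then have "(2::nat) ^ Suc k \<le> 2 ^ l" by (intro power_increasing) auto
    then show "branch w k \<noteq> branch w l" using branch_level [of w k] branch_level [of w l] by auto
  qed
  have X: "{i \<in> {1..<M}. X i w} = branch w ` {..n}"
  proof (intro equalityI subsetI)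
    fix i assume i: "i \<in> {i \<in> {1..<M}. X i w}"
    then obtain t where t: "t \<le> n" "i \<in> {2 ^ t..<2 ^ Suc t}"
      using exists_heap_level [of i n] M by blast
    moreover have "i = branch w t" using X_iff_branch [of i t w] i t by simp
    ultimately show "i \<in> branch w ` {..n}" by simp
  next
    fix i assume "i \<in> branch w ` {..n}"
    then obtain k where k: "k \<le> n" "i = branch w k" by auto
    then show "i \<in> {i \<in> {1..<M}. X i w}"
      using br [OF k(1)] X_iff_branch [OF branch_level] by auto
  qed
  have bv: "b i (k, w div 2 ^ (Q - k)) = (if k = \<kappa> i \<and> X i w then \<epsilon> i (w div 2 ^ (Q - k)) else 0)"
    if "i \<in> {1..<M}" for i k
    using X_div_mem_B [of i w] that w by (auto simp: block_def)
  have "(\<Sum>k\<le>N. (embed \<alpha> (k, w div 2 ^ (Q - k)))\<^sup>2) =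
      (\<Sum>k\<in>\<kappa> ` {1..<M}. (embed \<alpha> (k, w div 2 ^ (Q - k)))\<^sup>2)"
  proof (rule sum.mono_neutral_right)
    show "\<kappa> ` {1..<M} \<subseteq> {..N}" using \<kappa>_le by auto
    show "\<forall>k\<in>{..N} - \<kappa> ` {1..<M}. (embed \<alpha> (k, w div 2 ^ (Q - k)))\<^sup>2 = 0"
      by (auto simp: embed_def bv intro!: sum.neutral)
  qed simp
  also have "\<dots> = (\<Sum>i\<in>{1..<M}. (embed \<alpha> (\<kappa> i, w div 2 ^ (Q - \<kappa> i)))\<^sup>2)"
    using inj_\<kappa> by (subst sum.reindex) auto
  also have "\<dots> = (\<Sum>i\<in>{1..<M}. of_bool (X i w) * (\<alpha> i)\<^sup>2)"
  proof (intro sum.cong refl)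
    fix i assume i: "i \<in> {1..<M}"
    \<comment> \<open>By injectivity of \<open>\<kappa>\<close> no other block has coefficients on
      level \<open>\<kappa> i\<close>.\<close>
    have "embed \<alpha> (\<kappa> i, w div 2 ^ (Q - \<kappa> i)) =
        (\<Sum>j\<in>{i}. \<alpha> j * b j (\<kappa> i, w div 2 ^ (Q - \<kappa> i)))"
      unfolding embed_def using i inj_\<kappa>
      by (intro sum.mono_neutral_right) (auto simp: bv inj_on_eq_iff)
    then show "(embed \<alpha> (\<kappa> i, w div 2 ^ (Q - \<kappa> i)))\<^sup>2 = of_bool (X i w) * (\<alpha> i)\<^sup>2"
      using i by (simp add: bv power_mult_distrib)
  qed
  also have "\<dots> = (\<Sum>i\<in>branch w ` {..n}. (\<alpha> i)\<^sup>2)"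
    unfolding X [symmetric] by (rule sum.mono_neutral_cong_right) auto
  also have "\<dots> = (\<Sum>k\<le>n. (\<alpha> (branch w n div 2 ^ (n - k)))\<^sup>2)"
    by (subst sum.reindex [OF inj_b]) (auto simp: branch_div intro!: sum.cong)
  finally show ?thesis by (simp add: path_norm_def L2_set_def)
qed

end

text \<open>Adding an index \<open>x\<close> to \<open>B\<close> contributes its diagonal entry and
  the cross terms, which are linear in the sign of \<open>x\<close>. That sign is chosen to make the
  cross terms nonnegative.\<close>

lemma exists_signs:
  fixes t :: "nat \<Rightarrow> nat \<Rightarrow> real"
  assumes "finite B"
  shows "\<exists>e. (\<forall>v. \<bar>e v\<bar> = 1) \<and> (\<Sum>u\<in>B. \<Sum>v\<in>B. e u * t u v * e v) \<ge> (\<Sum>v\<in>B. t v v)"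
  using assms
proof (induction B rule: finite_induct)
  case empty
  show ?case by (intro exI [of _ "\<lambda>v. 1"]) simp
next
  case (insert x B)
  then obtain e where e: "\<And>v. \<bar>e v\<bar> = 1" "(\<Sum>u\<in>B. \<Sum>v\<in>B. e u * t u v * e v) \<ge> (\<Sum>v\<in>B. t v v)"
    by blast
  define c where "c = (\<Sum>v\<in>B. t x v * e v) + (\<Sum>u\<in>B. e u * t u x)"
  define s where "s = (if c \<ge> 0 then 1 else - 1 :: real)"
  define e' where "e' = e(x := s)"
  have e'B: "e' v = e v" if "v \<in> B" for v using that insert.hyps by (auto simp: e'_def)
  have e'x: "e' x = s" by (simp add: e'_def)
  have 1: "(\<Sum>v\<in>B. s * t x v * e v) = s * (\<Sum>v\<in>B. t x v * e v)"
    by (simp add: sum_distrib_left mult.assoc)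
  have 2: "(\<Sum>u\<in>B. e u * t u x * s) = s * (\<Sum>u\<in>B. e u * t u x)"
    by (simp add: sum_distrib_left mult_ac)
  have "(\<Sum>u\<in>insert x B. \<Sum>v\<in>insert x B. e' u * t u v * e' v) =
      s * t x x * s + (\<Sum>v\<in>B. s * t x v * e v) +
      ((\<Sum>u\<in>B. e u * t u x * s) + (\<Sum>u\<in>B. \<Sum>v\<in>B. e u * t u v * e v))"
    using insert.hyps by (simp add: sum.distrib e'x e'B cong: sum.cong)
  also have "\<dots> = t x x + s * c + (\<Sum>u\<in>B. \<Sum>v\<in>B. e u * t u v * e v)"
    unfolding 1 2 by (simp add: c_def s_def algebra_simps)
  also have "\<dots> \<ge> t x x + (\<Sum>v\<in>B. t v v)"
    using e(2) by (auto simp: s_def)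
  finally have "(\<Sum>v\<in>insert x B. t v v) \<le> (\<Sum>u\<in>insert x B. \<Sum>v\<in>insert x B. e' u * t u v * e' v)"
    using insert.hyps by simp
  moreover have "\<forall>v. \<bar>e' v\<bar> = 1" using e(1) by (simp add: e'_def s_def)
  ultimately show ?case by blast
qed

section \<open>Bounds for coefficients over several levels\<close>

lemma abs_le_path_norm:
  assumes "k \<le> N"
  shows "\<bar>g (k, w div 2 ^ (Suc N - k))\<bar> \<le> path_norm N g w"
  unfolding path_norm_def L2_set_def
  using assms by (intro real_le_rsqrt) (auto intro: member_le_sum)

lemma abs_le_of_norm_le:
  assumes "norm_le N g C" "K \<in> nodes N"
  shows "\<bar>g K\<bar> \<le> C"
proof -
  obtain k v where K: "K = (k, v)" "k \<le> N" "v < 2 ^ k" using assms(2) by (auto simp: nodes_def)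
  let ?w = "v * 2 ^ (Suc N - k)"
  have "(2::nat) ^ Suc N = 2 ^ k * 2 ^ (Suc N - k)" using K by (simp flip: power_add)
  then have "?w < 2 ^ Suc N" using K by simp
  then have "path_norm N g ?w \<le> C" using assms(1) by (auto simp: norm_le_def)
  then show ?thesis using abs_le_path_norm [of k N g ?w] K by simp
qed

text \<open>On each cell Cauchy-Schwarz over the levels in \<open>W\<close> gives the factor
  \<open>sqrt (card W)\<close>; averaging over the cells turns the sum into the level averages on
  the left.\<close>

lemma sum_levels_abs_le:
  assumes "norm_le N g C" "finite W" "W \<subseteq> {..N}"
  shows "(\<Sum>k\<in>W. \<Sum>v<2 ^ k. \<bar>g (k, v)\<bar> / 2 ^ k) \<le> sqrt (card W) * C"
proof -
  let ?Q = "Suc N"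
  have "(\<Sum>v<2 ^ k. \<bar>g (k, v)\<bar> / 2 ^ k) = (\<Sum>w<2 ^ ?Q. \<bar>g (k, w div 2 ^ (?Q - k))\<bar>) / 2 ^ ?Q" if "k \<in> W" for k
  proof -
    have k: "k \<le> ?Q" using that assms(3) by auto
    have "(2::real) ^ ?Q = 2 ^ k * 2 ^ (?Q - k)" using k by (simp flip: power_add del: power_Suc)
    then show ?thesis using sum_leaves_eq_sum_level [OF k, of "\<lambda>v. \<bar>g (k, v)\<bar>"]
      by (simp del: power_Suc add: sum_divide_distrib [symmetric])
  qed
  then have "(\<Sum>k\<in>W. \<Sum>v<2 ^ k. \<bar>g (k, v)\<bar> / 2 ^ k) =
      (\<Sum>k\<in>W. (\<Sum>w<2 ^ ?Q. \<bar>g (k, w div 2 ^ (?Q - k))\<bar>) / 2 ^ ?Q)"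
    by (rule sum.cong [OF refl])
  also have "\<dots> = (\<Sum>w<2 ^ ?Q. \<Sum>k\<in>W. \<bar>g (k, w div 2 ^ (?Q - k))\<bar>) / 2 ^ ?Q"
    unfolding sum_divide_distrib [symmetric] by (subst sum.swap) (rule refl)
  also have "\<dots> \<le> (\<Sum>w<(2::nat) ^ ?Q. sqrt (card W) * C) / 2 ^ ?Q"
  proof (intro divide_right_mono sum_mono)
    fix w assume w: "w \<in> {..<(2::nat) ^ ?Q}"
    have "(\<Sum>k\<in>W. \<bar>1\<bar> * \<bar>g (k, w div 2 ^ (?Q - k))\<bar>) \<le>
        L2_set (\<lambda>k. 1) W * L2_set (\<lambda>k. g (k, w div 2 ^ (?Q - k))) W"
      by (rule L2_set_mult_ineq)
    also have "\<dots> \<le> L2_set (\<lambda>k. 1) W * path_norm N g w"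
      unfolding path_norm_def using assms
      by (intro mult_left_mono) (auto simp: L2_set_def intro!: sum_mono2 sum_nonneg)
    also have "\<dots> \<le> L2_set (\<lambda>k. 1) W * C"
      using assms(1) w by (intro mult_left_mono) (auto simp: norm_le_def L2_set_nonneg)
    also have "L2_set (\<lambda>k. 1) W = sqrt (card W)" by (simp add: L2_set_def)
    finally show "(\<Sum>k\<in>W. \<bar>g (k, w div 2 ^ (?Q - k))\<bar>) \<le> sqrt (card W) * C" by simp
  qed simp
  finally show ?thesis by (simp del: power_Suc)
qed

section \<open>Choice of levels and signs\<close>

text \<open>Every path meets level \<open>\<kappa> i\<close> once, where the coefficient is 0, 1 or
  -1.\<close>

lemma norm_le_block:
  assumes "\<And>v. \<bar>\<epsilon> i v\<bar> = 1"
  shows "norm_le N (block Q \<kappa> \<epsilon> i) 1"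
  unfolding norm_le_def path_norm_def L2_set_def
proof (intro allI impI real_le_lsqrt)
  fix w :: nat
  have "(block Q \<kappa> \<epsilon> i K)\<^sup>2 \<le> of_bool (fst K = \<kappa> i)" for K
    using assms [of "snd K"] by (auto simp: block_def abs_square_le_1)
  then have "(\<Sum>k\<le>N. (block Q \<kappa> \<epsilon> i (k, w div 2 ^ (Suc N - k)))\<^sup>2) \<le> (\<Sum>k\<le>N. of_bool (k = \<kappa> i))"
    by (intro sum_mono) (metis fst_conv)
  also have "\<dots> \<le> 1" by (simp add: card_le_Suc0_iff_eq)
  finally show "(\<Sum>k\<le>N. (block Q \<kappa> \<epsilon> i (k, w div 2 ^ (Suc N - k)))\<^sup>2) \<le> 1\<^sup>2" by simp
qed simp_all

text \<open>Each coefficient of \<open>g\<close> is at most \<open>C\<close> in absolute value, and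
  the nodes of a single level have total length 1.\<close>

lemma pairing_block_le:
  assumes "\<And>v. \<bar>\<epsilon> i v\<bar> = 1" "\<kappa> i \<le> N" "norm_le N g C"
  shows "\<bar>\<Sum>K\<in>nodes N. g K * (block Q \<kappa> \<epsilon> i K * node_length K)\<bar> \<le> C"
proof -
  let ?B = "block_set Q \<kappa> \<epsilon> i"
  have B: "?B \<subseteq> {..<2 ^ \<kappa> i}" by (auto simp: block_set_def)
  have C: "\<bar>g (\<kappa> i, v)\<bar> \<le> C" if "v \<in> ?B" for v
    using that B assms by (intro abs_le_of_norm_le [OF assms(3)]) auto
  have "C \<ge> 0"
    using abs_le_of_norm_le [OF assms(3), of "(0, 0)"] by simp
  have "(\<Sum>K\<in>nodes N. g K * (block Q \<kappa> \<epsilon> i K * node_length K)) =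
      (\<Sum>K\<in>nodes N. block Q \<kappa> \<epsilon> i K * (g K * node_length K))"
    by (simp add: mult_ac)
  also have "\<dots> = (\<Sum>v\<in>?B. \<epsilon> i v * (g (\<kappa> i, v) / 2 ^ \<kappa> i))"
    using assms(2) by (subst sum_block) (simp_all add: node_length_def)
  also have "\<bar>\<dots>\<bar> \<le> (\<Sum>v\<in>?B. C / 2 ^ \<kappa> i)"
    using C assms(1)
    by (intro order_trans [OF sum_abs] sum_mono) (simp add: abs_mult divide_right_mono)
  also have "\<dots> \<le> (\<Sum>v<(2::nat) ^ \<kappa> i. C / 2 ^ \<kappa> i)"
    using B \<open>C \<ge> 0\<close> by (intro sum_mono2) auto
  finally show ?thesis by simp
qed

text \<open>Test the functional on \<open>sgn (\<phi> K) / \<surd>(card W)\<close>.\<close>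

lemma sum_levels_functional_le:
  assumes W: "finite W" "W \<subseteq> {..N}" "W \<noteq> {}"
    and \<phi>: "\<And>a. norm_le N a 1 \<Longrightarrow> (\<Sum>K\<in>nodes N. a K * \<phi> K) \<le> C"
  shows "(\<Sum>k\<in>W. \<Sum>v<2 ^ k. \<bar>\<phi> (k, v)\<bar>) \<le> sqrt (card W) * C"
proof -
  define a where "a K = (if fst K \<in> W then sgn (\<phi> K) / sqrt (card W) else 0)" for K
  have W0: "card W > 0" using W by (simp add: card_gt_0_iff)
  have "norm_le N a 1"
    unfolding norm_le_def path_norm_def L2_set_def
  proof (intro allI impI real_le_lsqrt)
    fix w :: nat
    have "(\<Sum>k\<le>N. (a (k, w div 2 ^ (Suc N - k)))\<^sup>2) \<le> (\<Sum>k\<le>N. if k \<in> W then 1 / card W else 0)"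
      by (intro sum_mono) (auto simp: a_def power_divide sgn_if)
    also have "\<dots> = (\<Sum>k\<in>W. 1 / card W)"
      using W by (subst sum.If_cases) (auto simp: Int_absorb1)
    also have "\<dots> \<le> 1\<^sup>2" using W0 by simp
    finally show "(\<Sum>k\<le>N. (a (k, w div 2 ^ (Suc N - k)))\<^sup>2) \<le> 1\<^sup>2" .
  qed simp_all
  then have "(\<Sum>K\<in>nodes N. a K * \<phi> K) \<le> C" by (rule \<phi>)
  also have "(\<Sum>K\<in>nodes N. a K * \<phi> K) = (\<Sum>k\<in>W. \<Sum>v<2 ^ k. a (k, v) * \<phi> (k, v))"
    unfolding sum_nodes using W by (intro sum.mono_neutral_right) (auto simp: a_def)
  also have "\<dots> = (\<Sum>k\<in>W. \<Sum>v<2 ^ k. \<bar>\<phi> (k, v)\<bar>) / sqrt (card W)"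
    unfolding sum_divide_distrib
    by (intro sum.cong refl) (simp add: a_def abs_sgn mult.commute)
  finally show ?thesis using W0 by (simp add: field_simps)
qed

text \<open>Averaging over the levels in \<open>W\<close>: the entries paired with a fixed
  \<open>\<beta> j\<close> form a bounded functional, and the image of \<open>\<beta> j\<close> has
  bounded norm, so both kinds of sums over all of \<open>W\<close> are at most
  \<open>sqrt (card W) * \<Gamma>\<close>. Absolute values over a whole level are used because its
  signs and support are still to be chosen.\<close>

lemma exists_level:
  fixes c :: "nat \<times> nat \<Rightarrow> nat \<times> nat \<Rightarrow> real" and \<Gamma> :: real
  assumes c: "\<And>a. norm_le N a 1 \<Longrightarrow> norm_le N (\<lambda>L. \<Sum>K\<in>nodes N. a K * c K L) \<Gamma>"
    and W: "finite W" "W \<subseteq> {..N}" "W \<noteq> {}"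
    and \<beta>: "\<And>j. j \<in> J \<Longrightarrow> norm_le N (\<beta> j) 1"
      "\<And>j g. j \<in> J \<Longrightarrow> norm_le N g \<Gamma> \<Longrightarrow> \<bar>\<Sum>K\<in>nodes N. g K * (\<beta> j K * node_length K)\<bar> \<le> \<Gamma>"
  shows "\<exists>k\<in>W. (\<Sum>j\<in>J. (\<Sum>v<2 ^ k. \<bar>\<Sum>L\<in>nodes N. c (k, v) L * (\<beta> j L * node_length L)\<bar>) +
      (\<Sum>v<2 ^ k. \<bar>\<Sum>K\<in>nodes N. \<beta> j K * c K (k, v)\<bar> / 2 ^ k)) \<le> 2 * card J * \<Gamma> / sqrt (card W)"
    (is "\<exists>k\<in>W. (\<Sum>j\<in>J. ?f j k + ?g j k) \<le> ?r")
proof (rule ccontr)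
  assume "\<not> ?thesis"
  then have less: "?r < (\<Sum>j\<in>J. ?f j k + ?g j k)" if "k \<in> W" for k
    using that by force
  have W0: "card W > 0" using W by (simp add: card_gt_0_iff)
  have f: "(\<Sum>k\<in>W. ?f j k) \<le> sqrt (card W) * \<Gamma>" if "j \<in> J" for j
  proof (rule sum_levels_functional_le [OF W])
    fix a assume "norm_le N a 1"
    then have "\<bar>\<Sum>L\<in>nodes N. (\<Sum>K\<in>nodes N. a K * c K L) * (\<beta> j L * node_length L)\<bar> \<le> \<Gamma>"
      using c \<beta>(2) that by blast
    moreover have "(\<Sum>L\<in>nodes N. (\<Sum>K\<in>nodes N. a K * c K L) * (\<beta> j L * node_length L)) =
        (\<Sum>K\<in>nodes N. a K * (\<Sum>L\<in>nodes N. c K L * (\<beta> j L * node_length L)))"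
      unfolding sum_distrib_left sum_distrib_right mult.assoc by (rule sum.swap)
    ultimately show "(\<Sum>K\<in>nodes N. a K * (\<Sum>L\<in>nodes N. c K L * (\<beta> j L * node_length L))) \<le> \<Gamma>"
      by simp
  qed
  have g: "(\<Sum>k\<in>W. ?g j k) \<le> sqrt (card W) * \<Gamma>" if "j \<in> J" for j
    by (rule sum_levels_abs_le [OF c [OF \<beta>(1) [OF that]] W(1,2)])
  have "card W * ?r = (\<Sum>k\<in>W. ?r)" by simp
  also have "\<dots> < (\<Sum>k\<in>W. \<Sum>j\<in>J. ?f j k + ?g j k)"
    using W less by (intro sum_strict_mono) auto
  also have "\<dots> = (\<Sum>j\<in>J. (\<Sum>k\<in>W. ?f j k) + (\<Sum>k\<in>W. ?g j k))"
    by (subst sum.swap) (simp add: sum.distrib)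
  also have "\<dots> \<le> (\<Sum>j\<in>J. sqrt (card W) * \<Gamma> + sqrt (card W) * \<Gamma>)"
    using f g by (intro sum_mono add_mono)
  also have "\<dots> = card W * ?r"
    using W0 real_div_sqrt [of "card W"] by (simp add: field_simps)
  finally show False by simp
qed

text \<open>If \<open>c K L\<close> is the coefficient at \<open>L\<close> of the image of
  \<open>h_K\<close> under an operator, this is the pairing of the image of \<open>a\<close> with
  \<open>b\<close>; \<open>node_length L\<close> is the squared L2 norm of
  \<open>h_L\<close>.\<close>

definition bilinear :: "nat \<Rightarrow> (nat \<times> nat \<Rightarrow> nat \<times> nat \<Rightarrow> real) \<Rightarrow> (nat \<times> nat \<Rightarrow> real) \<Rightarrow> (nat \<times> nat \<Rightarrow> real) \<Rightarrow> real" where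
  "bilinear N c a b = (\<Sum>K\<in>nodes N. a K * (\<Sum>L\<in>nodes N. c K L * (b L * node_length L)))"

lemma bilinear_swap: "bilinear N c a b = (\<Sum>L\<in>nodes N. b L * ((\<Sum>K\<in>nodes N. a K * c K L) * node_length L))"
proof -
  have "bilinear N c a b = (\<Sum>K\<in>nodes N. \<Sum>L\<in>nodes N. a K * (c K L * (b L * node_length L)))"
    by (simp add: bilinear_def sum_distrib_left)
  also have "\<dots> = (\<Sum>L\<in>nodes N. \<Sum>K\<in>nodes N. a K * (c K L * (b L * node_length L)))"
    by (rule sum.swap)
  also have "\<dots> = (\<Sum>L\<in>nodes N. b L * ((\<Sum>K\<in>nodes N. a K * c K L) * node_length L))"
    by (intro sum.cong refl) (simp add: sum_distrib_left sum_distrib_right mult_ac)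
  finally show ?thesis .
qed

text \<open>The right side involves neither signs nor support, so bounds found when selecting the
  level survive all later choices.\<close>

lemma abs_sum_block_le:
  assumes "\<And>v. \<bar>\<epsilon> i v\<bar> = 1" "\<kappa> i \<le> N"
  shows "\<bar>\<Sum>K\<in>nodes N. block Q \<kappa> \<epsilon> i K * G K\<bar> \<le> (\<Sum>v<2 ^ \<kappa> i. \<bar>G (\<kappa> i, v)\<bar>)"
proof -
  have "\<bar>\<Sum>K\<in>nodes N. block Q \<kappa> \<epsilon> i K * G K\<bar> \<le> (\<Sum>v\<in>block_set Q \<kappa> \<epsilon> i. \<bar>G (\<kappa> i, v)\<bar>)"
    unfolding sum_block [of \<kappa> i N, OF assms(2)] using assms(1)
    by (intro order_trans [OF sum_abs] sum_mono) (simp add: abs_mult)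
  also have "\<dots> \<le> (\<Sum>v<2 ^ \<kappa> i. \<bar>G (\<kappa> i, v)\<bar>)"
    by (intro sum_mono2) (auto simp: block_set_def)
  finally show ?thesis .
qed

text \<open>Block \<open>i\<close> takes its level from the window
  \<open>{i * m..<Suc i * m}\<close>, so levels increase with \<open>i\<close>. In the inductive
  step the level is chosen to make the pairings with earlier blocks small, then the signs to keep
  the diagonal entry at least \<open>\<delta>\<close> times the measure of the support.\<close>

lemma exists_blocks:
  fixes c :: "nat \<times> nat \<Rightarrow> nat \<times> nat \<Rightarrow> real"
    and N M m :: nat and \<Gamma> \<delta> \<theta> :: real
  assumes c: "\<And>a. norm_le N a 1 \<Longrightarrow> norm_le N (\<lambda>L. \<Sum>K\<in>nodes N. a K * c K L) \<Gamma>"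
    and diag: "\<And>K. K \<in> nodes N \<Longrightarrow> \<delta> \<le> c K K"
    and N: "N = M * m" "m > 0" and \<Gamma>: "\<Gamma> > 0" and small: "2 * M * \<Gamma> / sqrt m \<le> \<theta>"
    and "I \<le> M"
  shows "\<exists>\<kappa> \<epsilon>. (\<forall>i v. \<bar>\<epsilon> i v\<bar> = 1) \<and>
      (\<forall>i\<in>{1..<I}. \<kappa> i \<in> {i * m..<Suc i * m} \<and>
         bilinear N c (block (Suc N) \<kappa> \<epsilon> i) (block (Suc N) \<kappa> \<epsilon> i) \<ge> \<delta> * (card (block_set (Suc N) \<kappa> \<epsilon> i) / 2 ^ \<kappa> i)) \<and>
      (\<forall>i\<in>{1..<I}. \<forall>j\<in>{1..<I}. i \<noteq> j \<longrightarrow>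
         \<bar>bilinear N c (block (Suc N) \<kappa> \<epsilon> i) (block (Suc N) \<kappa> \<epsilon> j)\<bar> \<le> \<theta>)"
  using assms(7)
proof (induction I)
  case 0
  show ?case by (intro exI [of _ "\<lambda>_. 0"] exI [of _ "\<lambda>_ _. 1"]) simp
next
  case (Suc I)
  let ?Q = "Suc N"
  have "I \<le> M" using Suc.prems by simp
  from Suc.IH [OF this] obtain \<kappa> \<epsilon> where \<epsilon>: "\<And>i v. \<bar>\<epsilon> i v\<bar> = 1"
    and \<kappa>: "\<And>i. i \<in> {1..<I} \<Longrightarrow> \<kappa> i \<in> {i * m..<Suc i * m}"
    and D: "\<And>i. i \<in> {1..<I} \<Longrightarrow> bilinear N c (block ?Q \<kappa> \<epsilon> i) (block ?Q \<kappa> \<epsilon> i) \<ge>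
        \<delta> * (card (block_set ?Q \<kappa> \<epsilon> i) / 2 ^ \<kappa> i)"
    and O: "\<And>i j. i \<in> {1..<I} \<Longrightarrow> j \<in> {1..<I} \<Longrightarrow> i \<noteq> j \<Longrightarrow>
        \<bar>bilinear N c (block ?Q \<kappa> \<epsilon> i) (block ?Q \<kappa> \<epsilon> j)\<bar> \<le> \<theta>"
    by blast
  have window: "k \<le> N" if "i < M" "k \<in> {i * m..<Suc i * m}" for i k
  proof -
    have "Suc i * m \<le> M * m" using that by (intro mult_le_mono1) simp
    then show ?thesis using that N by simp
  qed
  have \<kappa>N: "\<kappa> j \<le> N" if "j \<in> {1..<I}" for j
    using window [of j "\<kappa> j"] \<kappa> [OF that] that Suc.prems by simp
  define W where "W = {I * m..<Suc I * m}"
  have W: "finite W" "W \<subseteq> {..N}" "W \<noteq> {}" "card W = m"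
    using window [of I] Suc.prems N by (auto simp: W_def)
  have "\<exists>k\<in>W. (\<Sum>j\<in>{1..<I}.
      (\<Sum>v<2 ^ k. \<bar>\<Sum>L\<in>nodes N. c (k, v) L * (block ?Q \<kappa> \<epsilon> j L * node_length L)\<bar>) +
      (\<Sum>v<2 ^ k. \<bar>\<Sum>K\<in>nodes N. block ?Q \<kappa> \<epsilon> j K * c K (k, v)\<bar> / 2 ^ k)) \<le>
      2 * card {1..<I} * \<Gamma> / sqrt (card W)"
    using W \<epsilon> \<kappa>N
    by (intro exists_level [OF c] norm_le_block pairing_block_le) auto
  then obtain k where k: "k \<in> W" and level: "(\<Sum>j\<in>{1..<I}.
      (\<Sum>v<2 ^ k. \<bar>\<Sum>L\<in>nodes N. c (k, v) L * (block ?Q \<kappa> \<epsilon> j L * node_length L)\<bar>) +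
      (\<Sum>v<2 ^ k. \<bar>\<Sum>K\<in>nodes N. block ?Q \<kappa> \<epsilon> j K * c K (k, v)\<bar> / 2 ^ k)) \<le>
      2 * card {1..<I} * \<Gamma> / sqrt (card W)" (is "(\<Sum>j\<in>_. ?f j + ?g j) \<le> _")
    by blast
  have "2 * card {1..<I} * \<Gamma> / sqrt (card W) \<le> 2 * M * \<Gamma> / sqrt m"
    unfolding W(4) using Suc.prems \<Gamma> by (intro divide_right_mono mult_right_mono) auto
  with level small have fg: "(\<Sum>j\<in>{1..<I}. ?f j + ?g j) \<le> \<theta>" by linarith
  have f0: "?f j \<ge> 0" and g0: "?g j \<ge> 0" for j by (auto intro!: sum_nonneg)
  have fg1: "?f j + ?g j \<le> \<theta>" if "j \<in> {1..<I}" for j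
    using f0 g0 member_le_sum [of j "{1..<I}" "\<lambda>j. ?f j + ?g j"] that fg
    by (smt (verit) finite_atLeastLessThan member_le_sum Diff_iff)
  have f: "?f j \<le> \<theta>" and g: "?g j \<le> \<theta>" if "j \<in> {1..<I}" for j
    using fg1 [OF that] f0 [of j] g0 [of j] by linarith+
  have kN: "k \<le> N" using k W by auto
  define \<kappa>' where "\<kappa>' = \<kappa>(I := k)"
  \<comment> \<open>The support of block \<open>I\<close> depends only on signs of its ancestors, so
    it is known before the signs of block \<open>I\<close> itself.\<close>
  define B where "B = block_set ?Q \<kappa>' \<epsilon> I"
  have Bk: "v \<in> B \<Longrightarrow> v < 2 ^ k" for v by (simp add: B_def block_set_def \<kappa>'_def)
  \<comment> \<open>The matrix contains the pairings of images of Haar functions with Haar functions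
    inside the support; dividing by \<open>2 ^ k\<close> accounts for
    \<open>node_length\<close>.\<close>
  obtain e where e: "\<And>v. \<bar>e v\<bar> = 1"
    "(\<Sum>u\<in>B. \<Sum>v\<in>B. e u * (c (k, u) (k, v) / 2 ^ k) * e v) \<ge> (\<Sum>v\<in>B. c (k, v) (k, v) / 2 ^ k)"
    using exists_signs [of B "\<lambda>u v. c (k, u) (k, v) / 2 ^ k"] by (auto simp: B_def)
  define \<epsilon>' where "\<epsilon>' = \<epsilon>(I := e)"
  have \<epsilon>': "\<bar>\<epsilon>' i v\<bar> = 1" for i v using \<epsilon> e by (simp add: \<epsilon>'_def)
  have \<kappa>'I: "\<kappa>' I = k" and \<epsilon>'I: "\<epsilon>' I = e" by (simp_all add: \<kappa>'_def \<epsilon>'_def)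
  have old: "block ?Q \<kappa>' \<epsilon>' j = block ?Q \<kappa> \<epsilon> j" "block_set ?Q \<kappa>' \<epsilon>' j = block_set ?Q \<kappa> \<epsilon> j"
    "\<kappa>' j = \<kappa> j" if "j \<in> {1..<I}" for j
  proof -
    show "block ?Q \<kappa>' \<epsilon>' j = block ?Q \<kappa> \<epsilon> j"
      using that by (intro block_cong) (auto simp: \<kappa>'_def \<epsilon>'_def)
    show "block_set ?Q \<kappa>' \<epsilon>' j = block_set ?Q \<kappa> \<epsilon> j"
      using that by (intro block_set_cong) (auto simp: \<kappa>'_def \<epsilon>'_def)
    show "\<kappa>' j = \<kappa> j" using that by (simp add: \<kappa>'_def)
  qed
  have B: "block_set ?Q \<kappa>' \<epsilon>' I = B"
    unfolding B_def by (rule block_set_cong) (auto simp: \<epsilon>'_def)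
  let ?b = "block ?Q \<kappa>' \<epsilon>' I"
  have sum_b: "(\<Sum>K\<in>nodes N. ?b K * G K) = (\<Sum>v\<in>B. e v * G (k, v))" for G
    using sum_block [of \<kappa>' I N ?Q \<epsilon>' G] kN by (simp add: \<kappa>'I \<epsilon>'I B)
  have inner: "(\<Sum>L\<in>nodes N. c (k, u) L * (?b L * node_length L)) =
      (\<Sum>v\<in>B. e v * (c (k, u) (k, v) / 2 ^ k))" for u
    using sum_b [of "\<lambda>L. c (k, u) L * node_length L"] by (simp add: mult_ac node_length_def)
  have "bilinear N c ?b ?b = (\<Sum>u\<in>B. \<Sum>v\<in>B. e u * (c (k, u) (k, v) / 2 ^ k) * e v)"
    unfolding bilinear_def sum_b inner by (simp add: sum_distrib_left mult_ac)
  also have "\<dots> \<ge> (\<Sum>v\<in>B. \<delta> / 2 ^ k)"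
    using Bk kN by (intro order_trans [OF _ e(2)] sum_mono divide_right_mono diag) auto
  finally have diagI: "\<delta> * (card B / 2 ^ k) \<le> bilinear N c ?b ?b" by (simp add: mult.commute)
  have offI: "\<bar>bilinear N c ?b (block ?Q \<kappa> \<epsilon> j)\<bar> \<le> \<theta>" "\<bar>bilinear N c (block ?Q \<kappa> \<epsilon> j) ?b\<bar> \<le> \<theta>"
    if "j \<in> {1..<I}" for j
  proof -
    have "\<bar>bilinear N c ?b (block ?Q \<kappa> \<epsilon> j)\<bar> \<le> ?f j"
      unfolding bilinear_def using abs_sum_block_le [OF \<epsilon>', of \<kappa>' I N] kN by (simp add: \<kappa>'I)
    then show "\<bar>bilinear N c ?b (block ?Q \<kappa> \<epsilon> j)\<bar> \<le> \<theta>" using f [OF that] by linarith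
    have "\<bar>bilinear N c (block ?Q \<kappa> \<epsilon> j) ?b\<bar> \<le> (\<Sum>v<2 ^ k. \<bar>(\<Sum>K\<in>nodes N. block ?Q \<kappa> \<epsilon> j K * c K (k, v)) * node_length (k, v)\<bar>)"
      unfolding bilinear_swap using abs_sum_block_le [OF \<epsilon>', of \<kappa>' I N] kN by (simp add: \<kappa>'I)
    also have "\<dots> = ?g j" by (simp add: node_length_def)
    finally show "\<bar>bilinear N c (block ?Q \<kappa> \<epsilon> j) ?b\<bar> \<le> \<theta>" using g [OF that] by linarith
  qed
  have cases: "i \<in> {1..<I} \<or> i = I" if "i \<in> {1..<Suc I}" for i using that by auto
  have "\<forall>i\<in>{1..<Suc I}. \<kappa>' i \<in> {i * m..<Suc i * m} \<and>
      bilinear N c (block ?Q \<kappa>' \<epsilon>' i) (block ?Q \<kappa>' \<epsilon>' i) \<ge> \<delta> * (card (block_set ?Q \<kappa>' \<epsilon>' i) / 2 ^ \<kappa>' i)"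
  proof
    fix i assume "i \<in> {1..<Suc I}"
    with cases consider "i \<in> {1..<I}" | "i = I" by blast
    then show "\<kappa>' i \<in> {i * m..<Suc i * m} \<and>
      bilinear N c (block ?Q \<kappa>' \<epsilon>' i) (block ?Q \<kappa>' \<epsilon>' i) \<ge> \<delta> * (card (block_set ?Q \<kappa>' \<epsilon>' i) / 2 ^ \<kappa>' i)"
    proof cases
      case 1
      then show ?thesis unfolding old [OF 1] using \<kappa> D by blast
    next
      case 2
      then show ?thesis using diagI k by (simp add: B \<kappa>'I W_def)
    qed
  qed
  moreover have "\<forall>i\<in>{1..<Suc I}. \<forall>j\<in>{1..<Suc I}. i \<noteq> j \<longrightarrow>
      \<bar>bilinear N c (block ?Q \<kappa>' \<epsilon>' i) (block ?Q \<kappa>' \<epsilon>' j)\<bar> \<le> \<theta>"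
  proof (intro ballI impI)
    fix i j assume "i \<in> {1..<Suc I}" "j \<in> {1..<Suc I}" "i \<noteq> j"
    with cases consider "i \<in> {1..<I}" "j \<in> {1..<I}" | "i = I" "j \<in> {1..<I}" | "i \<in> {1..<I}" "j = I"
      by blast
    then show "\<bar>bilinear N c (block ?Q \<kappa>' \<epsilon>' i) (block ?Q \<kappa>' \<epsilon>' j)\<bar> \<le> \<theta>"
      by cases (use O offI \<open>i \<noteq> j\<close> in \<open>auto simp: old\<close>)
  qed
  ultimately show ?case using \<epsilon>' by blast
qed

text \<open>The iterates of minus \<open>F\<close> on \<open>y\<close> are bounded by a geometric
  series, because the absolute row sums are at most \<open>q\<close>. Their sum solves the
  system.\<close>

lemma neumann_solution:
  fixes F :: "'a \<Rightarrow> 'a \<Rightarrow> real"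
  assumes "finite A" and F: "\<And>i. i \<in> A \<Longrightarrow> (\<Sum>j\<in>A. \<bar>F i j\<bar>) \<le> q" and "0 \<le> q" "q < 1"
  shows "\<exists>x. \<forall>i\<in>A. x i + (\<Sum>j\<in>A. F i j * x j) = y i"
proof -
  define u where "u k = ((\<lambda>x i. - (\<Sum>j\<in>A. F i j * x j)) ^^ k) y" for k
  define Y where "Y = (\<Sum>i\<in>A. \<bar>y i\<bar>)"
  have u_Suc: "u (Suc k) i = - (\<Sum>j\<in>A. F i j * u k j)" for k i by (simp add: u_def)
  have u_le: "\<bar>u k i\<bar> \<le> q ^ k * Y" if "i \<in> A" for k i
    using that
  proof (induction k arbitrary: i)
    case 0
    then show ?case using member_le_sum [of i A "\<lambda>i. \<bar>y i\<bar>"] assms(1) by (simp add: u_def Y_def)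
  next
    case (Suc k)
    have "\<bar>u (Suc k) i\<bar> \<le> (\<Sum>j\<in>A. \<bar>F i j\<bar> * (q ^ k * Y))"
      unfolding u_Suc abs_minus_cancel using Suc.IH
      by (intro order_trans [OF sum_abs] sum_mono) (simp add: abs_mult mult_left_mono)
    also have "\<dots> = (\<Sum>j\<in>A. \<bar>F i j\<bar>) * (q ^ k * Y)" by (simp add: sum_distrib_right)
    also have "\<dots> \<le> q * (q ^ k * Y)"
      using F [OF Suc.prems] assms(3) by (intro mult_right_mono) (auto simp: Y_def sum_nonneg)
    finally show ?case by simp
  qed
  have sm: "summable (\<lambda>k. u k i)" if "i \<in> A" for i
  proof (rule summable_comparison_test')
    show "summable (\<lambda>k. q ^ k * Y)" using assms by (intro summable_mult2 summable_geometric) simp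
  qed (use u_le [OF that] in simp)
  define x where "x i = (\<Sum>k. u k i)" for i
  have "x i + (\<Sum>j\<in>A. F i j * x j) = y i" if "i \<in> A" for i
  proof -
    have "(\<Sum>j\<in>A. F i j * x j) = (\<Sum>k. \<Sum>j\<in>A. F i j * u k j)"
      unfolding x_def using sm by (subst suminf_sum) (auto simp: suminf_mult summable_mult)
    also have "\<dots> = - (\<Sum>k. u (Suc k) i)"
      unfolding u_Suc using sm by (subst suminf_minus) (auto intro!: summable_sum summable_mult)
    also have "(\<Sum>k. u (Suc k) i) = x i - u 0 i"
      unfolding x_def by (rule suminf_split_head [OF sm [OF that]])
    finally show ?thesis by (simp add: u_def)
  qed
  then show ?thesis by blast
qed

section \<open>Nearly diagonal matrices\<close>

text \<open>The counterpart of \<open>path_norm\<close> for families indexed by heap positions: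
  \<open>J\<close> is a position on level \<open>n\<close> and \<open>J div 2 ^ (n - k)\<close> is
  its ancestor on level \<open>k\<close>.\<close>

definition tree_norm :: "nat \<Rightarrow> (nat \<Rightarrow> real) \<Rightarrow> nat \<Rightarrow> real" where
  "tree_norm n \<alpha> J = L2_set (\<lambda>k. \<alpha> (J div 2 ^ (n - k))) {..n}"

definition heap_index :: "nat \<times> nat \<Rightarrow> nat" where
  "heap_index K = 2 ^ fst K + snd K"

lemma abs_le_tree_norm: "k \<le> n \<Longrightarrow> \<bar>\<alpha> (J div 2 ^ (n - k))\<bar> \<le> tree_norm n \<alpha> J"
  unfolding tree_norm_def L2_set_def by (intro real_le_rsqrt) (auto intro: member_le_sum)

lemma exists_descendant:
  fixes i :: nat
  assumes "i \<in> {1..<2 ^ Suc n}"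
  obtains J k where "J \<in> {2 ^ n..<2 ^ Suc n}" "k \<le> n" "J div 2 ^ (n - k) = i"
proof -
  obtain t where t: "t \<le> n" "i \<in> {2 ^ t..<2 ^ Suc t}" using exists_heap_level [OF assms] .
  have "(2::nat) ^ n = 2 ^ t * 2 ^ (n - t)" using t(1) by (simp flip: power_add)
  then have "i * 2 ^ (n - t) \<in> {2 ^ n..<2 ^ Suc n}" using t by simp
  then show ?thesis using that [of "i * 2 ^ (n - t)" t] t(1) by simp
qed

lemma heap_index_level:
  assumes "v < 2 ^ k"
  shows "heap_index (k, v) \<in> {2 ^ k..<2 ^ Suc k}"
  using assms by (simp add: heap_index_def)

lemma inj_on_heap_index: "inj_on heap_index (nodes n)"
proof (rule inj_onI)
  fix K L assume KL: "K \<in> nodes n" "L \<in> nodes n" and eq: "heap_index K = heap_index L"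
  obtain k v l w where K: "K = (k, v)" "v < 2 ^ k" and L: "L = (l, w)" "w < 2 ^ l"
    using KL by (cases K; cases L) auto
  have lev: "heap_index K \<in> {2 ^ k..<2 ^ Suc k}" "heap_index K \<in> {2 ^ l..<2 ^ Suc l}"
    using heap_index_level [OF K(2)] heap_index_level [OF L(2)] eq by (simp_all add: K(1) L(1))
  have "\<not> k < l" "\<not> l < k"
    using lev power_increasing [of "Suc k" l "2::nat"] power_increasing [of "Suc l" k "2::nat"] by fastforce+
  then have "k = l" by simp
  then show "K = L" using eq by (simp add: K L heap_index_def)
qed

lemma heap_index_image: "heap_index ` nodes n = {1..<2 ^ Suc n}"
proof (intro equalityI subsetI)
  fix i assume "i \<in> heap_index ` nodes n"
  then obtain k v where i: "i = heap_index (k, v)" "k \<le> n" "v < 2 ^ k" by auto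
  have "(2::nat) ^ Suc k \<le> 2 ^ Suc n" using i(2) by (intro power_increasing) auto
  moreover have "(1::nat) \<le> 2 ^ k" by simp
  ultimately show "i \<in> {1..<2 ^ Suc n}"
    using heap_index_level [OF i(3)] unfolding i(1) atLeastLessThan_iff by linarith
next
  fix i :: nat assume "i \<in> {1..<2 ^ Suc n}"
  then obtain t where "t \<le> n" "i \<in> {2 ^ t..<2 ^ Suc t}" using exists_heap_level by metis
  then have "i = heap_index (t, i - 2 ^ t)" "(t, i - 2 ^ t) \<in> nodes n" by (auto simp: heap_index_def)
  then show "i \<in> heap_index ` nodes n" by blast
qed

text \<open>Cells lie one level below the last coefficients, so the path norm on \<open>w\<close>
  depends only on \<open>w div 2\<close>, which corresponds to the position
  \<open>2 ^ n + w div 2\<close>.\<close>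

lemma norm_le_heap:
  "norm_le n (\<lambda>K. \<alpha> (heap_index K)) D \<longleftrightarrow> (\<forall>J\<in>{2 ^ n..<2 ^ Suc n}. tree_norm n \<alpha> J \<le> D)"
proof -
  have eq: "path_norm n (\<lambda>K. \<alpha> (heap_index K)) w = tree_norm n \<alpha> (2 ^ n + w div 2)" for w
    unfolding path_norm_def tree_norm_def
  proof (rule L2_set_cong [OF refl])
    fix k assume "k \<in> {..n}"
    then have k: "k \<le> n" by simp
    have "(2::nat) ^ n = 2 ^ k * 2 ^ (n - k)" using k by (simp flip: power_add)
    then have "(2 ^ n + w div 2) div 2 ^ (n - k) = 2 ^ k + (w div 2) div 2 ^ (n - k)" by simp
    also have "(w div 2) div 2 ^ (n - k) = w div 2 ^ (Suc n - k)"
      using k by (simp add: Suc_diff_le div_mult2_eq)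
    finally show "\<alpha> (heap_index (k, w div 2 ^ (Suc n - k))) = \<alpha> ((2 ^ n + w div 2) div 2 ^ (n - k))"
      by (simp add: heap_index_def)
  qed
  show ?thesis
  proof (intro iffI ballI)
    fix J assume J: "J \<in> {2 ^ n..<(2::nat) ^ Suc n}" and nl: "norm_le n (\<lambda>K. \<alpha> (heap_index K)) D"
    have "2 * (J - 2 ^ n) < 2 ^ Suc n" "2 ^ n + 2 * (J - 2 ^ n) div 2 = J" using J by auto
    with nl show "tree_norm n \<alpha> J \<le> D" using eq [of "2 * (J - 2 ^ n)"] unfolding norm_le_def by metis
  next
    assume D: "\<forall>J\<in>{2 ^ n..<2 ^ Suc n}. tree_norm n \<alpha> J \<le> D"
    show "norm_le n (\<lambda>K. \<alpha> (heap_index K)) D"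
      unfolding norm_le_def eq
    proof (intro allI impI)
      fix w :: nat assume "w < 2 ^ Suc n"
      then have "w div 2 < 2 ^ n" by simp
      then show "tree_norm n \<alpha> (2 ^ n + w div 2) \<le> D" using D by simp
    qed
  qed
qed

text \<open>Here \<open>A i j\<close> is to be the pairing of the image of block \<open>i\<close>
  with block \<open>j\<close>, and \<open>\<mu>\<close> the masses. In the bound on
  \<open>\<theta>\<close>, \<open>\<theta> * 2 ^ n / \<delta>\<close> bounds an off-diagonal entry
  divided by a diagonal one, \<open>2 ^ Suc n\<close> exceeds the number of indices and
  \<open>n + 1\<close> is the length of a path. The value \<open>\<eta> / (1 + \<eta>)\<close> is
  what yields the factor \<open>1 + \<eta>\<close> in the end.\<close>

locale near_diagonal =
  fixes n :: nat and A :: "nat \<Rightarrow> nat \<Rightarrow> real" and \<mu> :: "nat \<Rightarrow> real" and \<delta> \<eta> \<theta> :: real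
  assumes \<delta>: "\<delta> > 0" and \<eta>: "\<eta> > 0"
    and \<mu>: "\<And>j. j \<in> {1..<2 ^ Suc n} \<Longrightarrow> 1 / 2 ^ n \<le> \<mu> j"
    and diag: "\<And>j. j \<in> {1..<2 ^ Suc n} \<Longrightarrow> \<delta> * \<mu> j \<le> A j j"
    and off: "\<And>i j. i \<in> {1..<2 ^ Suc n} \<Longrightarrow> j \<in> {1..<2 ^ Suc n} \<Longrightarrow> i \<noteq> j \<Longrightarrow> \<bar>A i j\<bar> \<le> \<theta>"
    and \<theta>: "\<theta> > 0" "(real n + 1) * (2 ^ Suc n * (\<theta> * 2 ^ n / \<delta>)) \<le> \<eta> / (1 + \<eta>)"
begin

definition q :: real where
  "q = 2 ^ Suc n * (\<theta> * 2 ^ n / \<delta>)"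

text \<open>The indices are swapped because the unknowns multiply \<open>A\<close> from the left:
  equation \<open>j\<close> uses column \<open>j\<close> of \<open>A\<close> and is divided by
  \<open>A j j\<close>.\<close>

definition F :: "nat \<Rightarrow> nat \<Rightarrow> real" where
  "F j i = (if i = j then 0 else A i j / A j j)"

lemma q_nonneg: "0 \<le> q" and q_le: "(real n + 1) * q \<le> \<eta> / (1 + \<eta>)" and q_less_1: "q < 1"
proof -
  show q: "0 \<le> q" using \<theta> \<delta> by (simp add: q_def)
  show le: "(real n + 1) * q \<le> \<eta> / (1 + \<eta>)" using \<theta> by (simp add: q_def)
  have "q \<le> (real n + 1) * q" using q by (simp add: distrib_right)
  moreover have "\<eta> / (1 + \<eta>) < 1" using \<eta> by simp
  ultimately show "q < 1" using le by linarith
qed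

lemma A_diag:
  assumes "j \<in> {1..<2 ^ Suc n}"
  shows "0 < \<mu> j" "\<delta> / 2 ^ n \<le> A j j" "0 < A j j"
proof -
  have "\<delta> * (1 / 2 ^ n) \<le> \<delta> * \<mu> j" using \<mu> [OF assms] \<delta> by (intro mult_left_mono) auto
  then show "\<delta> / 2 ^ n \<le> A j j" using diag [OF assms] by simp
  moreover have "0 < \<delta> / 2 ^ n" using \<delta> by simp
  ultimately show "0 < A j j" by linarith
  have "0 < 1 / (2::real) ^ n" by simp
  then show "0 < \<mu> j" using \<mu> [OF assms] by linarith
qed

lemma F_le:
  assumes "i \<in> {1..<2 ^ Suc n}" "j \<in> {1..<2 ^ Suc n}"
  shows "\<bar>F j i\<bar> \<le> \<theta> * 2 ^ n / \<delta>"
proof (cases "i = j")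
  case False
  have "\<bar>A i j\<bar> / A j j \<le> \<theta> / (\<delta> / 2 ^ n)"
    using off [OF assms False] A_diag [OF assms(2)] \<delta> \<theta> by (intro frac_le) auto
  then show ?thesis using False A_diag(3) [OF assms(2)] by (simp add: F_def abs_divide)
qed (use \<theta> \<delta> in \<open>simp add: F_def\<close>)

lemma sum_F_le:
  assumes j: "j \<in> {1..<2 ^ Suc n}" and Y: "\<And>i. i \<in> {1..<2 ^ Suc n} \<Longrightarrow> \<bar>\<alpha> i\<bar> \<le> Y" "0 \<le> Y"
  shows "\<bar>\<Sum>i\<in>{1..<2 ^ Suc n}. F j i * \<alpha> i\<bar> \<le> q * Y"
proof -
  have "\<bar>\<Sum>i\<in>{1..<2 ^ Suc n}. F j i * \<alpha> i\<bar> \<le> (\<Sum>i\<in>{1..<(2::nat) ^ Suc n}. \<theta> * 2 ^ n / \<delta> * Y)"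
  proof (rule order_trans [OF sum_abs], rule sum_mono)
    fix i :: nat assume i: "i \<in> {1..<2 ^ Suc n}"
    show "\<bar>F j i * \<alpha> i\<bar> \<le> \<theta> * 2 ^ n / \<delta> * Y"
      unfolding abs_mult using F_le [OF i j] Y(1) [OF i] \<theta> \<delta> by (intro mult_mono) auto
  qed
  also have "\<dots> = real (2 ^ Suc n - 1) * (\<theta> * 2 ^ n / \<delta> * Y)" by (simp del: power_Suc)
  also have "\<dots> \<le> 2 ^ Suc n * (\<theta> * 2 ^ n / \<delta> * Y)"
    using \<theta> \<delta> Y(2) by (intro mult_right_mono) (auto simp: of_nat_diff)
  finally show ?thesis by (simp add: q_def)
qed

lemma solution_iff:
  assumes "j \<in> {1..<2 ^ Suc n}"
  shows "(\<Sum>i\<in>{1..<2 ^ Suc n}. \<alpha> i * A i j) = \<beta> j * \<mu> j \<longleftrightarrow>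
    \<alpha> j + (\<Sum>i\<in>{1..<2 ^ Suc n}. F j i * \<alpha> i) = \<beta> j * \<mu> j / A j j"
proof -
  let ?M = "{1..<(2::nat) ^ Suc n}"
  have "A j j * (\<Sum>i\<in>?M. F j i * \<alpha> i) = (\<Sum>i\<in>?M. if i = j then 0 else \<alpha> i * A i j)"
    using A_diag(3) [OF assms] by (auto simp: sum_distrib_left F_def intro!: sum.cong)
  also have "\<dots> = (\<Sum>i\<in>?M. \<alpha> i * A i j) - \<alpha> j * A j j"
    using assms by (subst (2) sum.remove [of _ j]) (auto simp: sum.remove [of _ j] intro!: sum.cong)
  finally show ?thesis using A_diag(3) [OF assms] by (simp add: field_simps)
qed

lemma exists_solution:
  "\<exists>\<alpha>. \<forall>j\<in>{1..<2 ^ Suc n}. (\<Sum>i\<in>{1..<2 ^ Suc n}. \<alpha> i * A i j) = \<beta> j * \<mu> j"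
proof -
  have "\<exists>\<alpha>. \<forall>j\<in>{1..<2 ^ Suc n}. \<alpha> j + (\<Sum>i\<in>{1..<2 ^ Suc n}. F j i * \<alpha> i) = \<beta> j * \<mu> j / A j j"
  proof (rule neumann_solution)
    fix j :: nat assume j: "j \<in> {1..<2 ^ Suc n}"
    \<comment> \<open>With the signs of the entries as test vector, \<open>sum_F_le\<close> bounds
      the absolute row sum.\<close>
    have "(\<Sum>i\<in>{1..<2 ^ Suc n}. \<bar>F j i\<bar>) = (\<Sum>i\<in>{1..<2 ^ Suc n}. F j i * sgn (F j i))"
      by (simp add: abs_sgn)
    also have "\<dots> \<le> q * 1"
      by (rule order_trans [OF abs_ge_self sum_F_le [OF j]]) (simp_all add: abs_sgn_eq)
    finally show "(\<Sum>i\<in>{1..<2 ^ Suc n}. \<bar>F j i\<bar>) \<le> q" by simp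
  qed (use q_nonneg q_less_1 in auto)
  then show ?thesis using solution_iff by blast
qed

text \<open>An a priori estimate: with \<open>Y\<close> the largest tree norm of
  \<open>\<alpha>\<close>, each equation gives an error of at most \<open>q * Y\<close> beside the
  main term. The triangle inequality on a path attaining \<open>Y\<close> then bounds
  \<open>Y\<close> by \<open>D / \<delta> + \<eta> / (1 + \<eta>) * Y\<close>, which is solved for
  \<open>Y\<close>.\<close>

lemma solution_bound:
  assumes sol: "\<And>j. j \<in> {1..<2 ^ Suc n} \<Longrightarrow> (\<Sum>i\<in>{1..<2 ^ Suc n}. \<alpha> i * A i j) = \<beta> j * \<mu> j"
    and \<beta>: "\<And>J. J \<in> {2 ^ n..<2 ^ Suc n} \<Longrightarrow> tree_norm n \<beta> J \<le> D"
    and J: "J \<in> {2 ^ n..<2 ^ Suc n}"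
  shows "tree_norm n \<alpha> J \<le> (1 + \<eta>) / \<delta> * D"
proof -
  let ?L = "{2 ^ n..<(2::nat) ^ Suc n}"
  define Y where "Y = Max (tree_norm n \<alpha> ` ?L)"
  have Y: "tree_norm n \<alpha> I \<le> Y" if "I \<in> ?L" for I using that unfolding Y_def by (intro Max_ge) auto
  have Y0: "0 \<le> Y" using order_trans [OF _ Y [OF J]] by (simp add: tree_norm_def L2_set_nonneg)
  have "Y \<in> tree_norm n \<alpha> ` ?L" unfolding Y_def using J by (intro Max_in) blast+
  then obtain I where I: "I \<in> ?L" "tree_norm n \<alpha> I = Y" by auto
  have \<alpha>Y: "\<bar>\<alpha> i\<bar> \<le> Y" if i: "i \<in> {1..<2 ^ Suc n}" for i
  proof -
    obtain J k where "J \<in> ?L" "k \<le> n" "J div 2 ^ (n - k) = i" using exists_descendant [OF i] .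
    then show ?thesis using abs_le_tree_norm [of k n \<alpha> J] Y [of J] by simp
  qed
  have \<alpha>: "\<bar>\<alpha> j\<bar> \<le> \<bar>\<beta> j\<bar> / \<delta> + q * Y" if j: "j \<in> {1..<2 ^ Suc n}" for j
  proof -
    \<comment> \<open>The masses on the right side of the system cancel those in the diagonal bound,
      so the main term costs only the factor \<open>1 / \<delta>\<close>.\<close>
    have "\<mu> j / A j j \<le> 1 / \<delta>" using A_diag [OF j] diag [OF j] \<delta> by (simp add: field_simps)
    then have "\<bar>\<beta> j\<bar> * (\<mu> j / A j j) \<le> \<bar>\<beta> j\<bar> * (1 / \<delta>)" by (rule mult_left_mono) simp
    moreover have "\<bar>\<beta> j * \<mu> j / A j j\<bar> = \<bar>\<beta> j\<bar> * (\<mu> j / A j j)"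
      using A_diag [OF j] by (simp add: abs_mult)
    ultimately have "\<bar>\<beta> j * \<mu> j / A j j\<bar> \<le> \<bar>\<beta> j\<bar> / \<delta>" by simp
    moreover have "\<alpha> j + (\<Sum>i\<in>{1..<2 ^ Suc n}. F j i * \<alpha> i) = \<beta> j * \<mu> j / A j j"
      using sol [OF j] solution_iff [OF j] by blast
    moreover have "\<bar>\<Sum>i\<in>{1..<2 ^ Suc n}. F j i * \<alpha> i\<bar> \<le> q * Y"
      using \<alpha>Y Y0 by (rule sum_F_le [OF j])
    ultimately show ?thesis by linarith
  qed
  have "tree_norm n \<alpha> I \<le> L2_set (\<lambda>k. \<bar>\<beta> (I div 2 ^ (n - k))\<bar> / \<delta> + q * Y) {..n}"
    unfolding tree_norm_def L2_set_def
  proof (intro real_sqrt_le_mono sum_mono)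
    fix k assume k: "k \<in> {..n}"
    have "I div 2 ^ (n - k) \<in> {2 ^ k..<2 ^ Suc k}" using ancestor_level [OF I(1)] k by simp
    moreover have "(2::nat) ^ Suc k \<le> 2 ^ Suc n" using k by (intro power_increasing) auto
    moreover have "(1::nat) \<le> 2 ^ k" by simp
    ultimately have "I div 2 ^ (n - k) \<in> {1..<2 ^ Suc n}"
      unfolding atLeastLessThan_iff by linarith
    from \<alpha> [OF this] show "(\<alpha> (I div 2 ^ (n - k)))\<^sup>2 \<le>
        (\<bar>\<beta> (I div 2 ^ (n - k))\<bar> / \<delta> + q * Y)\<^sup>2"
      by (intro abs_le_square_iff [THEN iffD1]) linarith
  qed
  also have "\<dots> \<le> L2_set (\<lambda>k. \<bar>\<beta> (I div 2 ^ (n - k))\<bar> / \<delta>) {..n} + L2_set (\<lambda>k. q * Y) {..n}"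
    by (rule L2_set_triangle_ineq)
  also have "L2_set (\<lambda>k. \<bar>\<beta> (I div 2 ^ (n - k))\<bar> / \<delta>) {..n} = tree_norm n \<beta> I / \<delta>"
    using \<delta> by (simp add: tree_norm_def L2_set_def power_divide real_sqrt_divide flip: sum_divide_distrib)
  also have "L2_set (\<lambda>k. q * Y) {..n} \<le> (\<Sum>k\<le>n. q * Y)"
    using q_nonneg Y0 by (intro L2_set_le_sum) auto
  also have "(\<Sum>k\<le>n. q * Y) = ((real n + 1) * q) * Y" by simp
  also have "\<dots> \<le> \<eta> / (1 + \<eta>) * Y" using q_le Y0 by (rule mult_right_mono)
  also have "tree_norm n \<beta> I / \<delta> \<le> D / \<delta>" using \<beta> [OF I(1)] \<delta> by (simp add: divide_right_mono)
  finally have "Y \<le> D / \<delta> + \<eta> / (1 + \<eta>) * Y" by (simp add: I(2))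
  moreover have "(1 + \<eta>) * Y / (1 + \<eta>) = Y / (1 + \<eta>) + \<eta> / (1 + \<eta>) * Y"
    by (simp add: add_divide_distrib distrib_right)
  moreover have "(1 + \<eta>) * Y / (1 + \<eta>) = Y" using \<eta> by simp
  ultimately have "Y / (1 + \<eta>) \<le> D / \<delta>" by linarith
  then have "Y \<le> (1 + \<eta>) / \<delta> * D" using \<eta> by (simp add: pos_divide_le_eq mult.commute)
  then show ?thesis using Y [OF J] by linarith
qed

text \<open>The difference solves the system with right side 0, and \<open>solution_bound\<close>
  with \<open>D = 0\<close> forces it to vanish.\<close>

lemma solution_unique:
  assumes "\<And>j. j \<in> {1..<2 ^ Suc n} \<Longrightarrow> (\<Sum>i\<in>{1..<2 ^ Suc n}. \<alpha> i * A i j) = (\<Sum>i\<in>{1..<2 ^ Suc n}. \<alpha>' i * A i j)"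
    and i: "i \<in> {1..<2 ^ Suc n}"
  shows "\<alpha> i = \<alpha>' i"
proof -
  obtain J k where J: "J \<in> {2 ^ n..<2 ^ Suc n}" "k \<le> n" "J div 2 ^ (n - k) = i"
    using exists_descendant [OF i] .
  have "tree_norm n (\<lambda>i. \<alpha> i - \<alpha>' i) J \<le> (1 + \<eta>) / \<delta> * 0"
  proof (rule solution_bound [OF _ _ J(1)])
    fix j :: nat assume "j \<in> {1..<2 ^ Suc n}"
    then show "(\<Sum>i\<in>{1..<2 ^ Suc n}. (\<alpha> i - \<alpha>' i) * A i j) = 0 * \<mu> j"
      using assms(1) by (simp add: left_diff_distrib sum_subtractf)
  qed (simp add: tree_norm_def L2_set_def)
  then show ?thesis using abs_le_tree_norm [OF J(2), of "\<lambda>i. \<alpha> i - \<alpha>' i" J] J(3) by simp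
qed

text \<open>The choice is harmless: any two candidates agree on the index range, which also makes
  the map linear there.\<close>

definition solution :: "(nat \<Rightarrow> real) \<Rightarrow> nat \<Rightarrow> real" where
  "solution \<beta> = (SOME \<alpha>. \<forall>j\<in>{1..<2 ^ Suc n}. (\<Sum>i\<in>{1..<2 ^ Suc n}. \<alpha> i * A i j) = \<beta> j * \<mu> j)"

lemma solution:
  assumes "j \<in> {1..<2 ^ Suc n}"
  shows "(\<Sum>i\<in>{1..<2 ^ Suc n}. solution \<beta> i * A i j) = \<beta> j * \<mu> j"
  using someI_ex [OF exists_solution [of \<beta>]] assms unfolding solution_def by blast

lemma solution_eqI:
  assumes "\<And>j. j \<in> {1..<2 ^ Suc n} \<Longrightarrow> (\<Sum>i\<in>{1..<2 ^ Suc n}. \<alpha> i * A i j) = \<beta> j * \<mu> j"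
    and "i \<in> {1..<2 ^ Suc n}"
  shows "solution \<beta> i = \<alpha> i"
  by (rule solution_unique [OF trans [OF solution sym [OF assms(1)]] assms(2)])

end

section \<open>Finite Haar sums\<close>

definition dyadic :: "nat \<times> nat \<Rightarrow> real set" where
  "dyadic K = {real (snd K) / 2 ^ fst K ..< real (snd K + 1) / 2 ^ fst K}"

text \<open>The position of the level \<open>k\<close> dyadic interval containing \<open>x\<close>.
  For negative \<open>x\<close> the conversion \<open>nat\<close> returns 0, whence the condition
  \<open>0 \<le> x\<close> in the facts about it.\<close>

definition cell :: "nat \<Rightarrow> real \<Rightarrow> nat" where
  "cell k x = nat \<lfloor>x * 2 ^ k\<rfloor>"

definition haar_sum :: "nat \<Rightarrow> (nat \<times> nat \<Rightarrow> real) \<Rightarrow> real \<Rightarrow> real" where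
  "haar_sum N a x = (\<Sum>K\<in>nodes N. a K * haar (dyadic K) x)"

section \<open>Dyadic intervals and Haar functions in terms of cells\<close>

lemma cell_eq_iff:
  assumes "0 \<le> x"
  shows "cell k x = v \<longleftrightarrow> real v / 2 ^ k \<le> x \<and> x < real (v + 1) / 2 ^ k"
proof -
  have "cell k x = v \<longleftrightarrow> \<lfloor>x * 2 ^ k\<rfloor> = int v"
    unfolding cell_def using assms by (auto simp: nat_eq_iff)
  then show ?thesis by (auto simp: floor_eq_iff field_simps)
qed

lemma cell_less:
  assumes "0 \<le> x" "x < 1"
  shows "cell k x < 2 ^ k"
proof -
  have "x * 2 ^ k < 2 ^ k" using assms by simp
  then show ?thesis using assms by (simp add: cell_def nat_less_iff floor_less_iff)
qed

lemma cell_div: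
  assumes "0 \<le> x" "k \<le> l"
  shows "cell l x div 2 ^ (l - k) = cell k x"
proof -
  have "(2::real) ^ l = 2 ^ k * 2 ^ (l - k)" using assms by (simp flip: power_add)
  then have "x * 2 ^ k = (x * 2 ^ l) / of_int (2 ^ (l - k))" by simp
  then have "\<lfloor>x * 2 ^ k\<rfloor> = \<lfloor>x * 2 ^ l\<rfloor> div 2 ^ (l - k)"
    by (metis floor_divide_real_eq_div zero_le_numeral zero_le_power)
  then show ?thesis using assms by (simp add: cell_def nat_div_distrib nat_power_eq)
qed

lemma mem_dyadic_iff: "0 \<le> x \<Longrightarrow> x \<in> dyadic K \<longleftrightarrow> cell (fst K) x = snd K"
  by (auto simp: dyadic_def cell_eq_iff)

lemma dyadic_nonneg: "x \<in> dyadic K \<Longrightarrow> 0 \<le> x"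
  by (auto simp: dyadic_def intro: order_trans [rotated])

lemma dyadic_Inf_Sup:
  "Inf (dyadic K) = real (snd K) / 2 ^ fst K" "Sup (dyadic K) = real (snd K + 1) / 2 ^ fst K"
  unfolding dyadic_def by (simp_all add: divide_strict_right_mono)

lemma measure_dyadic: "measure lborel (dyadic K) = node_length K"
  by (simp add: dyadic_def node_length_def divide_right_mono field_simps)

lemma inj_dyadic: "inj dyadic"
proof (rule injI)
  fix K L assume eq: "dyadic K = dyadic L"
  then have "node_length K = node_length L" by (metis measure_dyadic)
  then have 1: "fst K = fst L" by (simp add: node_length_def)
  moreover have "snd K = snd L"
    using dyadic_Inf_Sup(1) [of K] dyadic_Inf_Sup(1) [of L] eq 1 by simp
  ultimately show "K = L" by (simp add: prod_eq_iff)
qed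

lemma dyadic_halves:
  "left_half (dyadic K) = dyadic (Suc (fst K), 2 * snd K)"
  "right_half (dyadic K) = dyadic (Suc (fst K), 2 * snd K + 1)"
  unfolding left_half_def right_half_def dyadic_Inf_Sup
  by (auto simp: dyadic_def field_simps)

lemma haar_dyadic:
  "haar (dyadic K) x = (if 0 \<le> x \<and> cell (fst K) x = snd K
     then (if even (cell (Suc (fst K)) x) then 1 else - 1) else 0)"
proof (cases "0 \<le> x")
  case True
  have "cell (fst K) x = cell (Suc (fst K)) x div 2" using cell_div [OF True, of "fst K" "Suc (fst K)"] by simp
  then show ?thesis using True
    by (auto simp: haar_def dyadic_halves mem_dyadic_iff indicator_def elim!: evenE oddE)
next
  case False
  then have "x \<notin> dyadic L" for L using dyadic_nonneg by blast
  then show ?thesis using False by (simp add: haar_def dyadic_halves)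
qed

lemma dyadic_intervals_eq: "dyadic_intervals = dyadic ` (SIGMA k:UNIV. {..<2 ^ k})"
proof (intro equalityI subsetI)
  fix I assume "I \<in> dyadic_intervals"
  then obtain m k where I: "I = {(real k - 1) / 2 ^ m ..< real k / 2 ^ m}" "1 \<le> k" "k \<le> 2 ^ m"
    by (auto simp: dyadic_intervals_def)
  then have "I = dyadic (m, k - 1)" by (simp add: dyadic_def of_nat_diff)
  then show "I \<in> dyadic ` (SIGMA k:UNIV. {..<2 ^ k})" using I by force
next
  fix I assume "I \<in> dyadic ` (SIGMA k:UNIV. {..<2 ^ k})"
  then obtain m v where I: "I = dyadic (m, v)" "v < 2 ^ m" by auto
  then have "I = {(real (v + 1) - 1) / 2 ^ m ..< real (v + 1) / 2 ^ m}" by (simp add: dyadic_def)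
  then show "I \<in> dyadic_intervals"
    unfolding dyadic_intervals_def using I(2) by (intro CollectI exI [of _ m] exI [of _ "v + 1"]) auto
qed

lemma dyadic_upto_eq: "dyadic_upto N = dyadic ` nodes N"
proof -
  have "dyadic_level k = dyadic ` ({k} \<times> {..<2 ^ k})" for k
    by (force simp: dyadic_level_def dyadic_intervals_eq measure_dyadic node_length_def)
  then show ?thesis by (force simp: dyadic_upto_def nodes_def)
qed

lemma sum_dyadic_upto: "(\<Sum>I\<in>dyadic_upto N. f I) = (\<Sum>K\<in>nodes N. f (dyadic K))"
  unfolding dyadic_upto_eq by (subst sum.reindex) (auto intro: inj_on_subset [OF inj_dyadic])

lemma SL_eq: "SL N = range (haar_sum N)"
proof (intro equalityI subsetI)
  fix f assume "f \<in> SL N"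
  then obtain a where "f = (\<lambda>x. \<Sum>I\<in>dyadic_upto N. a I * haar I x)" by (auto simp: SL_def)
  then have "f = haar_sum N (\<lambda>K. a (dyadic K))" by (simp add: haar_sum_def sum_dyadic_upto fun_eq_iff)
  then show "f \<in> range (haar_sum N)" by simp
next
  fix f assume "f \<in> range (haar_sum N)"
  then obtain a where a: "f = haar_sum N a" by auto
  have "f = (\<lambda>x. \<Sum>I\<in>dyadic_upto N. a (inv dyadic I) * haar I x)"
    by (simp add: a haar_sum_def sum_dyadic_upto fun_eq_iff inv_f_f [OF inj_dyadic])
  then show "f \<in> SL N" by (auto simp: SL_def)
qed

lemma haar_measurable [measurable]: "haar (dyadic K) \<in> borel_measurable borel"
  unfolding haar_def dyadic_halves by (simp add: dyadic_def)

lemma haar_outside: "K \<in> nodes N \<Longrightarrow> x \<notin> {0..<1} \<Longrightarrow> haar (dyadic K) x = 0"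
proof -
  assume K: "K \<in> nodes N" and x: "x \<notin> {0..<1}"
  have "cell (fst K) x \<noteq> snd K" if "1 \<le> x"
  proof -
    have "real (snd K + 1) / 2 ^ fst K \<le> 1"
      using K by (auto simp: nodes_def field_simps Suc_le_eq simp flip: of_nat_Suc)
    then show ?thesis using cell_eq_iff [of x "fst K" "snd K"] that by linarith
  qed
  then show ?thesis using x by (auto simp: haar_dyadic)
qed

section \<open>Orthogonality of the Haar functions\<close>

lemma integrable_dyadic: "integrable lborel (indicat_real (dyadic K))"
  by (intro integrable_real_indicator) (auto simp: dyadic_def emeasure_lborel_Ico divide_right_mono)

lemma integrable_haar: "integrable lborel (haar (dyadic K))"
  unfolding haar_def dyadic_halves by (intro Bochner_Integration.integrable_diff integrable_dyadic)

lemma integral_haar: "(LINT x|lborel. haar (dyadic K) x) = 0"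
  unfolding haar_def dyadic_halves
  by (subst Bochner_Integration.integral_diff)
    (simp_all add: integrable_dyadic, simp add: measure_dyadic node_length_def)

lemma haar_sq: "(haar (dyadic K) x)\<^sup>2 = indicat_real (dyadic K) x"
proof (cases "0 \<le> x")
  case True
  then show ?thesis by (simp add: haar_dyadic mem_dyadic_iff indicator_def)
next
  case False
  then have "x \<notin> dyadic K" using dyadic_nonneg by blast
  then show ?thesis using False by (simp add: haar_dyadic)
qed

text \<open>The coarser Haar function is constant on the interval of the finer one; its value there
  is read off at the left endpoint \<open>y\<close>.\<close>

lemma haar_mult_finer:
  assumes "fst K < fst L"
  shows "\<exists>c. \<forall>x. haar (dyadic K) x * haar (dyadic L) x = c * haar (dyadic L) x"
proof -
  define y where "y = real (snd L) / 2 ^ fst L"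
  have y: "0 \<le> y" "cell (fst L) y = snd L"
    by (auto simp: y_def cell_eq_iff divide_strict_right_mono)
  have "haar (dyadic K) x = haar (dyadic K) y" if "haar (dyadic L) x \<noteq> 0" for x
  proof -
    from that have x: "0 \<le> x" "cell (fst L) x = snd L" by (auto simp: haar_dyadic split: if_splits)
    then have "cell k x = cell k y" if "k \<le> fst L" for k
      using cell_div [OF x(1) that] cell_div [OF y(1) that] y by simp
    then show ?thesis using x y assms by (simp add: haar_dyadic)
  qed
  then show ?thesis by (metis mult_eq_0_iff)
qed

lemma integral_haar_mult:
  "integrable lborel (\<lambda>x. haar (dyadic K) x * haar (dyadic L) x) \<and>
   (LINT x|lborel. haar (dyadic K) x * haar (dyadic L) x) = (if K = L then node_length K else 0)"
proof -
  have finer: "integrable lborel (\<lambda>x. haar (dyadic K) x * haar (dyadic L) x) \<and>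
      (LINT x|lborel. haar (dyadic K) x * haar (dyadic L) x) = 0" if less: "fst K < fst L" for K L
  proof -
    obtain c where "\<And>x. haar (dyadic K) x * haar (dyadic L) x = c * haar (dyadic L) x"
      using haar_mult_finer [OF less] by blast
    then have "(\<lambda>x. haar (dyadic K) x * haar (dyadic L) x) = (\<lambda>x. c * haar (dyadic L) x)" by blast
    then show ?thesis by (simp only:) (simp add: integrable_haar integral_haar)
  qed
  consider "fst K < fst L" | "fst L < fst K" | "fst K = fst L" "K \<noteq> L" | "K = L" by linarith
  then show ?thesis
  proof cases
    case 1
    then show ?thesis using finer [OF 1] by auto
  next
    case 2
    then show ?thesis using finer [OF 2] by (auto simp: mult.commute)
  next
    case 3
    then have "(\<lambda>x. haar (dyadic K) x * haar (dyadic L) x) = (\<lambda>x. 0)"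
      by (auto simp: haar_dyadic prod_eq_iff fun_eq_iff)
    then show ?thesis using 3 by (simp only:) simp
  next
    case 4
    then show ?thesis
      using integrable_dyadic [of L] by (simp flip: power2_eq_square add: haar_sq measure_dyadic)
  qed
qed

lemma haar_sum_outside: "x \<notin> {0..<1} \<Longrightarrow> haar_sum N a x = 0"
  unfolding haar_sum_def using haar_outside [of _ N x] by (intro sum.neutral) simp

lemma integral_haar_sum_mult:
  "integrable lborel (\<lambda>x. haar_sum N a x * haar_sum N b x) \<and>
   (LINT x|lborel. haar_sum N a x * haar_sum N b x) = (\<Sum>K\<in>nodes N. a K * b K * node_length K)"
proof -
  have eq: "haar_sum N a x * haar_sum N b x =
      (\<Sum>K\<in>nodes N. \<Sum>L\<in>nodes N. (a K * b L) * (haar (dyadic K) x * haar (dyadic L) x))" for x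
    by (simp add: haar_sum_def sum_product mult_ac)
  have "(LINT x|lborel. haar_sum N a x * haar_sum N b x) =
      (\<Sum>K\<in>nodes N. \<Sum>L\<in>nodes N. (a K * b L) * (if K = L then node_length K else 0))"
    unfolding eq using integral_haar_mult
    by (subst Bochner_Integration.integral_sum integral_mult_right,
        auto intro!: Bochner_Integration.integrable_sum integrable_mult_right sum.cong
          simp: Bochner_Integration.integral_sum)
  also have "\<dots> = (\<Sum>K\<in>nodes N. a K * b K * node_length K)"
    by (intro sum.cong refl) (simp add: if_distrib sum.delta' cong: if_cong)
  finally have "(LINT x|lborel. haar_sum N a x * haar_sum N b x) = (\<Sum>K\<in>nodes N. a K * b K * node_length K)" .
  moreover have "integrable lborel (\<lambda>x. haar_sum N a x * haar_sum N b x)"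
    unfolding eq using integral_haar_mult
    by (intro Bochner_Integration.integrable_sum integrable_mult_right) blast
  ultimately show ?thesis by blast
qed

lemma integral_unit_measure:
  fixes f :: "real \<Rightarrow> real"
  assumes "\<And>x. x \<notin> {0..<1} \<Longrightarrow> f x = 0"
  shows "(LINT x|unit_measure. f x) = (LINT x|lborel. f x)" "integrable unit_measure f \<longleftrightarrow> integrable lborel f"
proof -
  have eq: "(\<lambda>x. indicator {0..<1} x *\<^sub>R f x) = f"
    using assms by (auto simp: fun_eq_iff indicator_def)
  show "(LINT x|unit_measure. f x) = (LINT x|lborel. f x)"
    by (subst integral_restrict_space) (simp_all only: eq, simp)
  show "integrable unit_measure f \<longleftrightarrow> integrable lborel f"
    by (subst integrable_restrict_space) (simp_all only: eq, simp)
qed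

lemma pairing_haar_sum: "pairing (haar_sum N a) (haar_sum N b) = (\<Sum>K\<in>nodes N. a K * b K * node_length K)"
proof -
  \<comment> \<open>The pairing integrates over the closed interval; Haar sums vanish at the
    endpoint 1.\<close>
  have "indicator {0..1} x *\<^sub>R (haar_sum N a x * haar_sum N b x) = haar_sum N a x * haar_sum N b x" for x
    using haar_sum_outside [of x N a] by (cases "x \<in> {0..<1}") auto
  then have "pairing (haar_sum N a) (haar_sum N b) = (LINT x|lborel. haar_sum N a x * haar_sum N b x)"
    unfolding pairing_def set_lebesgue_integral_def by (simp only:)
  then show ?thesis using integral_haar_sum_mult by simp
qed

lemma haar_sum_single: "K \<in> nodes N \<Longrightarrow> haar_sum N (\<lambda>L. of_bool (L = K)) = haar (dyadic K)"
  by (simp add: haar_sum_def fun_eq_iff)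

text \<open>A formula for the coefficients by orthogonality, indexed by nodes, in place of the
  definite description \<open>haar_coeffs\<close>, whose candidates are infinite expansions.\<close>

definition haar_coeff :: "(real \<Rightarrow> real) \<Rightarrow> nat \<times> nat \<Rightarrow> real" where
  "haar_coeff f K = pairing f (haar (dyadic K)) / node_length K"

lemma haar_coeff_haar_sum:
  assumes "K \<in> nodes N"
  shows "haar_coeff (haar_sum N a) K = a K"
proof -
  have "pairing (haar_sum N a) (haar (dyadic K)) = (\<Sum>L\<in>nodes N. of_bool (L = K) * (a L * node_length L))"
    unfolding haar_sum_single [OF assms, symmetric] pairing_haar_sum
    by (simp only: mult_ac)
  also have "\<dots> = a K * node_length K" using assms by simp
  finally show ?thesis by (simp add: haar_coeff_def node_length_def)
qed

lemma haar_sum_cong: "(\<And>K. K \<in> nodes N \<Longrightarrow> a K = b K) \<Longrightarrow> haar_sum N a = haar_sum N b"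
  by (auto simp: haar_sum_def fun_eq_iff intro!: sum.cong)

lemma haar_sum_haar_coeff: "f \<in> SL N \<Longrightarrow> haar_sum N (haar_coeff f) = f"
  by (auto simp: SL_eq haar_coeff_haar_sum intro!: haar_sum_cong)

lemma haar_sum_extend:
  assumes "m \<le> N"
  shows "haar_sum m a = haar_sum N (\<lambda>K. if K \<in> nodes m then a K else 0)"
proof
  fix x
  have "nodes m \<subseteq> nodes N" using assms by (auto simp: nodes_def)
  then show "haar_sum m a x = haar_sum N (\<lambda>K. if K \<in> nodes m then a K else 0) x"
    unfolding haar_sum_def by (intro sum.mono_neutral_cong_left) auto
qed

section \<open>Coefficients and norm of a finite Haar sum\<close>

lemma haar_sum_measurable [measurable]: "haar_sum N a \<in> borel_measurable borel"
  unfolding haar_sum_def [abs_def] by measurable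

text \<open>From level \<open>N\<close> on the partial sums with these coefficients equal the
  function. For any other expansion, orthogonality makes the L2 distance at least each single
  squared coefficient difference times its node length; as the distance tends to 0, the coefficients
  agree.\<close>

lemma haar_coeffs_haar_sum:
  "haar_coeffs (haar_sum N a) = (\<lambda>I. if I \<in> dyadic_upto N then a (inv dyadic I) else 0)"
  (is "_ = ?a")
  unfolding haar_coeffs_def
proof (rule the_equality)
  let ?f = "haar_sum N a"
  have partial: "(\<Sum>I\<in>dyadic_upto m. b I * haar I x) = haar_sum m (\<lambda>K. b (dyadic K)) x" for b m x
    by (simp add: haar_sum_def sum_dyadic_upto)
  have diff: "haar_sum m b x - haar_sum m c x = haar_sum m (\<lambda>K. b K - c K) x" for m b c x
    by (simp add: haar_sum_def sum_subtractf left_diff_distrib)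
  have a: "?a (dyadic K) = (if K \<in> nodes N then a K else 0)" for K
    by (auto simp: dyadic_upto_eq inv_f_f [OF inj_dyadic] dest: injD [OF inj_dyadic])
  have up: "?f = haar_sum m (\<lambda>K. ?a (dyadic K))" if "N \<le> m" for m
    unfolding a using haar_sum_extend [OF that] .
  have dist: "(LINT x|unit_measure. (?f x - (\<Sum>I\<in>dyadic_upto m. b I * haar I x))\<^sup>2) =
      (\<Sum>K\<in>nodes m. (?a (dyadic K) - b (dyadic K))\<^sup>2 * node_length K)" if "N \<le> m" for b m
  proof -
    have "(LINT x|unit_measure. (?f x - (\<Sum>I\<in>dyadic_upto m. b I * haar I x))\<^sup>2) =
        (LINT x|unit_measure. (haar_sum m (\<lambda>K. ?a (dyadic K) - b (dyadic K)) x)\<^sup>2)"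
      unfolding partial up [OF that] diff ..
    also have "\<dots> = (LINT x|lborel. (haar_sum m (\<lambda>K. ?a (dyadic K) - b (dyadic K)) x)\<^sup>2)"
      by (rule integral_unit_measure) (simp add: haar_sum_outside)
    finally show ?thesis
      unfolding power2_eq_square using integral_haar_sum_mult by simp
  qed
  show "haar_expansion ?f ?a"
    unfolding haar_expansion_def
  proof (intro conjI)
    show "?f \<in> borel_measurable unit_measure" by (intro measurable_restrict_space1) simp
    show "integrable unit_measure (\<lambda>x. (?f x)\<^sup>2)"
      by (subst integral_unit_measure)
        (simp_all add: haar_sum_outside power2_eq_square integral_haar_sum_mult)
    show "\<forall>I. I \<notin> dyadic_intervals \<longrightarrow> ?a I = 0"
      by (auto simp: dyadic_upto_def dyadic_level_def)
    show "(\<lambda>m. LINT x|unit_measure. (?f x - (\<Sum>I\<in>dyadic_upto m. ?a I * haar I x))\<^sup>2) \<longlonglongrightarrow> 0"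
    proof (rule tendsto_eventually)
      show "\<forall>\<^sub>F m in sequentially. (LINT x|unit_measure. (?f x - (\<Sum>I\<in>dyadic_upto m. ?a I * haar I x))\<^sup>2) = 0"
        using eventually_ge_at_top [of N] by eventually_elim (simp add: dist)
    qed
  qed
  fix b assume b: "haar_expansion ?f b"
  show "b = ?a"
  proof
    fix I
    show "b I = ?a I"
    proof (cases "I \<in> dyadic_intervals")
      case False
      then show ?thesis using b by (auto simp: haar_expansion_def dyadic_upto_def dyadic_level_def)
    next
      case True
      then obtain K where K: "I = dyadic K" "snd K < 2 ^ fst K" by (auto simp: dyadic_intervals_eq)
      have "\<forall>\<^sub>F m in sequentially. (?a I - b I)\<^sup>2 * node_length K \<le>
          (LINT x|unit_measure. (?f x - (\<Sum>I\<in>dyadic_upto m. b I * haar I x))\<^sup>2)"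
        using eventually_ge_at_top [of "max N (fst K)"]
      proof eventually_elim
        case (elim m)
        then have "N \<le> m" "K \<in> nodes m" using K(2) by (cases K; simp)+
        then have "(?a (dyadic K) - b (dyadic K))\<^sup>2 * node_length K \<le>
            (\<Sum>K\<in>nodes m. (?a (dyadic K) - b (dyadic K))\<^sup>2 * node_length K)"
          by (intro member_le_sum) (auto simp: node_length_def)
        then show ?case unfolding dist [OF \<open>N \<le> m\<close>] K(1) .
      qed
      then have "(?a I - b I)\<^sup>2 * node_length K \<le> 0"
        using b by (intro tendsto_lowerbound [of _ 0]) (auto simp: haar_expansion_def)
      moreover have "z = 0" if "z\<^sup>2 * node_length K \<le> 0" for z
        using that node_length_pos [of K] by (auto simp: mult_le_0_iff)
      ultimately have "?a I - b I = 0" by blast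
      then show ?thesis by linarith
    qed
  qed
qed

text \<open>The square of a Haar function is the indicator of its interval, so exactly one term per
  level survives at \<open>x\<close>.\<close>

lemma square_function_haar_sum:
  assumes "x \<in> {0..<1}"
  shows "square_function (haar_sum N a) x = path_norm N a (cell (Suc N) x)"
proof -
  have x: "0 \<le> x" "x < 1" using assms by auto
  have "(\<Sum>\<^sub>\<infinity>I\<in>dyadic_intervals. (haar_coeffs (haar_sum N a) I)\<^sup>2 * (haar I x)\<^sup>2) =
      (\<Sum>\<^sub>\<infinity>I\<in>dyadic_upto N. (haar_coeffs (haar_sum N a) I)\<^sup>2 * (haar I x)\<^sup>2)"
    by (rule infsum_cong_neutral)
      (auto simp: haar_coeffs_haar_sum dyadic_upto_def dyadic_level_def)
  also have "\<dots> = (\<Sum>I\<in>dyadic_upto N. (haar_coeffs (haar_sum N a) I)\<^sup>2 * (haar I x)\<^sup>2)"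
    by (rule infsum_finite) (simp add: dyadic_upto_eq)
  also have "\<dots> = (\<Sum>K\<in>nodes N. (a K)\<^sup>2 * (haar (dyadic K) x)\<^sup>2)"
    unfolding sum_dyadic_upto by (intro sum.cong refl)
      (simp add: haar_coeffs_haar_sum dyadic_upto_eq inv_f_f [OF inj_dyadic])
  also have "\<dots> = (\<Sum>k\<le>N. \<Sum>v<2 ^ k. if v = cell k x then (a (k, v))\<^sup>2 else 0)"
    unfolding sum_nodes using x
    by (intro sum.cong refl) (simp add: haar_sq indicator_def mem_dyadic_iff)
  also have "\<dots> = (\<Sum>k\<le>N. (a (k, cell k x))\<^sup>2)"
    using cell_less [OF x] by (intro sum.cong refl) (simp add: sum.delta)
  also have "\<dots> = (\<Sum>k\<le>N. (a (k, cell (Suc N) x div 2 ^ (Suc N - k)))\<^sup>2)"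
    using x by (intro sum.cong refl) (subst cell_div, auto)
  finally show ?thesis by (simp add: square_function_def path_norm_def L2_set_def)
qed

lemma path_norm_nonneg: "0 \<le> path_norm N a w"
  by (simp add: path_norm_def L2_set_nonneg)

lemma SL_esssup_haar_sum:
  shows "\<exists>C\<ge>0. SL_esssup (haar_sum N a) = ereal C \<and> norm_le N a C \<and> (\<forall>D. norm_le N a D \<longrightarrow> C \<le> D)"
proof -
  let ?s = "\<lambda>x. path_norm N a (cell (Suc N) x)"
  define C where "C = Max (path_norm N a ` {..<2 ^ Suc N})"
  have C: "norm_le N a C" unfolding norm_le_def C_def by (auto intro!: Max_ge)
  obtain w where w: "w < 2 ^ Suc N" "path_norm N a w = C"
  proof -
    have "(0::nat) \<in> {..<2 ^ Suc N}" by simp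
    then have "C \<in> path_norm N a ` {..<2 ^ Suc N}" unfolding C_def by (intro Max_in) blast+
    then show ?thesis using that by auto
  qed
  have [measurable]: "?s \<in> borel_measurable borel"
    unfolding cell_def by measurable
  have sq: "square_function (haar_sum N a) x = ?s x" if "x \<in> space unit_measure" for x
    using that by (simp add: space_restrict_space square_function_haar_sum)
  have s_meas: "(\<lambda>x. ereal (?s x)) \<in> borel_measurable unit_measure"
    by (intro measurable_restrict_space1) simp
  moreover have "(\<lambda>x. ereal (square_function (haar_sum N a) x)) \<in> borel_measurable unit_measure"
    using s_meas by (rule iffD2 [OF measurable_cong, rotated]) (simp add: sq)
  ultimately have "SL_esssup (haar_sum N a) = esssup unit_measure (\<lambda>x. ereal (?s x))"
    unfolding SL_esssup_def by (intro esssup_AE_cong AE_I2) (simp_all add: sq)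
  also have "\<dots> = ereal C"
  proof (rule antisym)
    show "esssup unit_measure (\<lambda>x. ereal (?s x)) \<le> ereal C"
    proof (rule esssup_I)
      show "(\<lambda>x. ereal (?s x)) \<in> borel_measurable unit_measure" by (rule s_meas)
      show "AE x in unit_measure. ereal (?s x) \<le> ereal C"
        using C cell_less by (intro AE_I2) (auto simp: space_restrict_space norm_le_def simp del: power_Suc)
    qed
    show "ereal C \<le> esssup unit_measure (\<lambda>x. ereal (?s x))" (is "_ \<le> ?E")
    proof (rule ccontr)
      \<comment> \<open>On the cell \<open>w\<close> the square function attains its maximum
        \<open>C\<close>. If the essential supremum were smaller, this cell would be a null set, but
        it has positive length.\<close>
      let ?D = "dyadic (Suc N, w)"
      assume less: "\<not> ereal C \<le> ?E"
      have s: "x \<in> {0..<1} \<and> ?s x = C" if "x \<in> ?D" for x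
      proof -
        have x: "0 \<le> x" using dyadic_nonneg [OF that] .
        have "real (w + 1) / 2 ^ Suc N \<le> 1"
          using w(1) by (simp add: field_simps Suc_le_eq del: power_Suc of_nat_add of_nat_Suc)
        then have "x < 1" using that
          unfolding dyadic_def by (simp only: atLeastLessThan_iff fst_conv snd_conv) linarith
        then show ?thesis using x that w mem_dyadic_iff [OF x, of "(Suc N, w)"] by simp
      qed
      have "AE x in unit_measure. ereal (?s x) \<le> ?E" by (rule esssup_AE)
      then have "AE x in lborel. x \<in> {0..<1} \<longrightarrow> ereal (?s x) \<le> ?E"
        by (subst (asm) AE_restrict_space_iff) auto
      then have "AE x in lborel. x \<notin> ?D"
      proof eventually_elim
        case (elim x)
        then show ?case using s [of x] less by auto
      qed
      then have "?D \<in> null_sets lborel"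
        by (subst AE_iff_null_sets) (auto simp: dyadic_def)
      then have "measure lborel ?D = 0" by (simp add: measure_def null_setsD1)
      then show False by (simp add: measure_dyadic node_length_def)
    qed
  qed
  finally have "SL_esssup (haar_sum N a) = ereal C" .
  moreover have "C \<le> D" if "norm_le N a D" for D
    using that w by (auto simp: norm_le_def)
  moreover have "C \<ge> 0" using w path_norm_nonneg by metis
  ultimately show ?thesis using C by blast
qed

text \<open>The bridge to the combinatorial side: the norm is the least \<open>C\<close> with
  \<open>norm_le N a C\<close>.\<close>

lemma SL_norm_haar_sum:
  shows SL_norm_nonneg: "0 \<le> SL_norm (haar_sum N a)"
    and norm_le_SL_norm: "norm_le N a (SL_norm (haar_sum N a))"
    and SL_norm_le: "norm_le N a D \<Longrightarrow> SL_norm (haar_sum N a) \<le> D"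
  using SL_esssup_haar_sum [of N a] by (auto simp: SL_norm_def)

lemma haar_sum_mem_SL [simp]: "haar_sum N a \<in> SL N"
  by (simp add: SL_eq)

lemma SL_norm_zero [simp]: "SL_norm (\<lambda>x. 0) = 0"
proof -
  have "SL_norm (haar_sum 0 (\<lambda>_. 0)) = 0"
    by (intro antisym SL_norm_nonneg SL_norm_le) (simp add: norm_le_def path_norm_def L2_set_def)
  then show ?thesis by (simp add: haar_sum_def [abs_def])
qed

lemma zero_mem_SL [simp]: "(\<lambda>x. 0) \<in> SL N"
  using haar_sum_mem_SL [of N "\<lambda>_. 0"] by (simp add: haar_sum_def [abs_def])

section \<open>Operators in Haar coordinates\<close>

lemma haar_sum_add: "(\<lambda>x. haar_sum N a x + haar_sum N b x) = haar_sum N (\<lambda>K. a K + b K)"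
  by (simp add: haar_sum_def fun_eq_iff sum.distrib distrib_right)

lemma haar_sum_scale: "(\<lambda>x. c * haar_sum N a x) = haar_sum N (\<lambda>K. c * a K)"
  by (simp add: haar_sum_def fun_eq_iff sum_distrib_left mult.assoc)

lemma SL_add: "f \<in> SL N \<Longrightarrow> g \<in> SL N \<Longrightarrow> (\<lambda>x. f x + g x) \<in> SL N"
  by (auto simp: SL_eq haar_sum_add)

lemma operator_zero:
  assumes "is_operator m n T"
  shows "T (\<lambda>x. 0) = (\<lambda>x. 0)"
proof -
  have "\<forall>c. \<forall>f\<in>SL m. T (\<lambda>x. c * f x) = (\<lambda>x. c * T f x)"
    using assms by (simp add: is_operator_def)
  from this [rule_format, of "\<lambda>x. 0" 0] show ?thesis by simp
qed

lemma op_norm_le: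
  assumes "\<And>f. f \<in> SL m \<Longrightarrow> SL_norm f \<le> 1 \<Longrightarrow> SL_norm (T f) \<le> C"
  shows "op_norm m T \<le> C"
proof -
  have "(\<lambda>x. 0) \<in> {f \<in> SL m. SL_norm f \<le> 1}" by simp
  then show ?thesis unfolding op_norm_def by (intro cSUP_least) (blast, use assms in auto)
qed

text \<open>A real \<open>SUP\<close> dominates its members only if they are bounded above, which
  the boundedness in \<open>is_operator\<close> provides.\<close>

lemma le_op_norm:
  assumes "is_operator m n T" "f \<in> SL m" "SL_norm f \<le> 1"
  shows "SL_norm (T f) \<le> op_norm m T"
proof -
  obtain C where C: "\<And>f. f \<in> SL m \<Longrightarrow> SL_norm (T f) \<le> C * SL_norm f"
    using assms(1) unfolding is_operator_def by blast
  have "SL_norm (T f) \<le> \<bar>C\<bar>" if "f \<in> SL m" "SL_norm f \<le> 1" for f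
  proof -
    have "0 \<le> SL_norm f" using that(1) by (auto simp: SL_eq SL_norm_nonneg)
    then have "C * SL_norm f \<le> \<bar>C\<bar> * 1" using that(2) by (intro mult_mono) auto
    then show ?thesis using C [OF that(1)] by simp
  qed
  then have "bdd_above ((\<lambda>f. SL_norm (T f)) ` {f \<in> SL m. SL_norm f \<le> 1})"
    by (intro bdd_aboveI2 [of _ _ "\<bar>C\<bar>"]) auto
  then show ?thesis unfolding op_norm_def using assms by (intro cSUP_upper) auto
qed

lemma op_norm_nonneg: "is_operator m n T \<Longrightarrow> 0 \<le> op_norm m T"
  using le_op_norm [of m n T "\<lambda>x. 0"] by (simp add: operator_zero)

lemma operator_haar_sum:
  assumes "is_operator m n T"
  shows "T (haar_sum m a) = haar_sum n (\<lambda>L. \<Sum>K\<in>nodes m. a K * haar_coeff (T (haar (dyadic K))) L)"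
proof -
  let ?h = "\<lambda>K. haar (dyadic K)"
  have T: "f \<in> SL m \<Longrightarrow> T f \<in> SL n"
    "f \<in> SL m \<Longrightarrow> g \<in> SL m \<Longrightarrow> T (\<lambda>x. f x + g x) = (\<lambda>x. T f x + T g x)"
    "f \<in> SL m \<Longrightarrow> T (\<lambda>x. c * f x) = (\<lambda>x. c * T f x)" for f g c
    using assms by (auto simp: is_operator_def)
  have h: "?h K \<in> SL m" if "K \<in> nodes m" for K
    using haar_sum_mem_SL [of m "\<lambda>L. of_bool (L = K)"] by (simp only: haar_sum_single [OF that])
  have ch: "(\<lambda>x. a K * ?h K x) \<in> SL m" if "K \<in> nodes m" for K
  proof -
    have "(\<lambda>x. a K * haar_sum m (\<lambda>L. of_bool (L = K)) x) \<in> SL m" unfolding haar_sum_scale by simp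
    then show ?thesis by (simp only: haar_sum_single [OF that])
  qed
  \<comment> \<open>Membership in \<open>SL m\<close> is carried through the induction because
    linearity of \<open>T\<close> is available only there.\<close>
  have "T (\<lambda>x. \<Sum>K\<in>F. a K * ?h K x) = (\<lambda>x. \<Sum>K\<in>F. a K * T (?h K) x) \<and> (\<lambda>x. \<Sum>K\<in>F. a K * ?h K x) \<in> SL m"
    if "F \<subseteq> nodes m" for F
    using finite_subset [OF that finite_nodes] that
  proof (induction F rule: finite_induct)
    case empty
    then show ?case using operator_zero [OF assms] by simp
  next
    case (insert K F)
    then have K: "K \<in> nodes m" and IH: "T (\<lambda>x. \<Sum>K\<in>F. a K * ?h K x) = (\<lambda>x. \<Sum>K\<in>F. a K * T (?h K) x)"
      "(\<lambda>x. \<Sum>K\<in>F. a K * ?h K x) \<in> SL m" by auto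
    have "(\<lambda>x. a K * ?h K x + (\<Sum>K\<in>F. a K * ?h K x)) \<in> SL m"
      by (rule SL_add [OF ch [OF K] IH(2)])
    then show ?case
      using insert.hyps T(2) [OF ch [OF K] IH(2)] T(3) [OF h [OF K], of "a K"] IH(1) by simp
  qed
  from this [OF order_refl] have "T (haar_sum m a) = (\<lambda>x. \<Sum>K\<in>nodes m. a K * T (?h K) x)"
    by (simp add: haar_sum_def [abs_def])
  also have "\<dots> = (\<lambda>x. \<Sum>K\<in>nodes m. a K * haar_sum n (haar_coeff (T (?h K))) x)"
    using haar_sum_haar_coeff [OF T(1) [OF h]] by simp
  also have "\<dots> = haar_sum n (\<lambda>L. \<Sum>K\<in>nodes m. a K * haar_coeff (T (?h K)) L)"
    unfolding haar_sum_def fun_eq_iff sum_distrib_left sum_distrib_right mult.assoc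
    by (intro allI sum.swap)
  finally show ?thesis .
qed

text \<open>Reduces a map of functions to its action \<open>\<Phi>\<close> on coefficients.
  Linearity is required for families related on the nodes only, since
  \<open>haar_coeff_haar_sum\<close> gives the coefficients only there.\<close>

lemma is_operator_haar_sumI:
  assumes add: "\<And>a b c L. (\<And>K. K \<in> nodes m \<Longrightarrow> c K = a K + b K) \<Longrightarrow> L \<in> nodes n \<Longrightarrow> \<Phi> c L = \<Phi> a L + \<Phi> b L"
    and scale: "\<And>a b r L. (\<And>K. K \<in> nodes m \<Longrightarrow> b K = r * a K) \<Longrightarrow> L \<in> nodes n \<Longrightarrow> \<Phi> b L = r * \<Phi> a L"
    and bound: "\<And>a D. 0 \<le> D \<Longrightarrow> norm_le m a D \<Longrightarrow> norm_le n (\<Phi> a) (C * D)"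
    and "0 \<le> C"
  defines "T \<equiv> \<lambda>f. haar_sum n (\<Phi> (haar_coeff f))"
  shows "is_operator m n T" "op_norm m T \<le> C"
proof -
  have b: "SL_norm (T f) \<le> C * SL_norm f" if "f \<in> SL m" for f
  proof -
    have "norm_le m (haar_coeff f) (SL_norm f)" "0 \<le> SL_norm f"
      using norm_le_SL_norm [of m "haar_coeff f"] SL_norm_nonneg [of m "haar_coeff f"] haar_sum_haar_coeff [OF that] by simp_all
    then show ?thesis unfolding T_def by (intro SL_norm_le bound)
  qed
  show "op_norm m T \<le> C"
  proof (rule op_norm_le)
    fix f assume "f \<in> SL m" "SL_norm f \<le> 1"
    then show "SL_norm (T f) \<le> C"
      using b [of f] mult_left_mono [of "SL_norm f" 1 C] assms(4) by simp
  qed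
  show "is_operator m n T"
    unfolding is_operator_def
  proof (intro conjI ballI allI)
    show "T \<in> SL m \<rightarrow> SL n" by (simp add: T_def)
    show "\<exists>C. \<forall>f\<in>SL m. SL_norm (T f) \<le> C * SL_norm f" using b by blast
  next
    fix f g assume "f \<in> SL m" "g \<in> SL m"
    then show "T (\<lambda>x. f x + g x) = (\<lambda>x. T f x + T g x)"
      by (auto simp: SL_eq T_def haar_sum_add haar_coeff_haar_sum intro!: haar_sum_cong add)
  next
    fix c f assume "f \<in> SL m"
    then show "T (\<lambda>x. c * f x) = (\<lambda>x. c * T f x)"
      by (auto simp: SL_eq T_def haar_sum_scale haar_coeff_haar_sum intro!: haar_sum_cong scale)
  qed
qed

section \<open>Factorization of the identity\<close>

lemma norm_le_mono: "norm_le N a C \<Longrightarrow> C \<le> D \<Longrightarrow> norm_le N a D"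
  by (auto simp: norm_le_def intro: order_trans)

text \<open>The square function sees only absolute values, so a Haar multiplier bounded by 1 is a
  contraction.\<close>

lemma norm_le_mult:
  assumes "\<And>K. \<bar>s K\<bar> \<le> 1" "norm_le N g C"
  shows "norm_le N (\<lambda>K. g K * s K) C"
proof -
  have "(g K * s K)\<^sup>2 \<le> (g K)\<^sup>2" for K
    using assms(1) [of K] by (auto simp: power_mult_distrib abs_square_le_1 intro!: mult_left_le)
  then have "path_norm N (\<lambda>K. g K * s K) w \<le> path_norm N g w" for w
    unfolding path_norm_def L2_set_def by (intro real_sqrt_le_mono sum_mono)
  then show ?thesis using assms(2) by (auto simp: norm_le_def intro: order_trans)
qed

lemma norm_le_SL_operator:
  assumes T: "is_operator m n T" "op_norm m T \<le> \<Gamma>" and "norm_le m a 1"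
  shows "norm_le n (\<lambda>L. \<Sum>K\<in>nodes m. a K * haar_coeff (T (haar (dyadic K))) L) \<Gamma>"
proof -
  have "SL_norm (T (haar_sum m a)) \<le> \<Gamma>"
    using le_op_norm [OF T(1), of "haar_sum m a"] SL_norm_le [OF assms(3)] T(2) by simp
  then show ?thesis
    using norm_le_SL_norm unfolding operator_haar_sum [OF T(1)] by (rule norm_le_mono [rotated])
qed

theorem theorem2p1:
  fixes n :: nat and \<Gamma> \<eta> \<delta> :: real
  assumes "\<Gamma> > 0" and "\<eta> > 0" and "\<delta> > 0"
  shows "\<exists>N::nat. \<forall>T.
           is_operator N N T \<and> op_norm N T \<le> \<Gamma> \<and>
           (\<forall>K\<in>dyadic_upto N. \<bar>pairing (T (haar K)) (haar K)\<bar> \<ge> \<delta> * measure lborel K)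
           \<longrightarrow> (\<exists>R S. is_operator n N R \<and> is_operator N n S \<and>
                  (\<forall>f\<in>SL n. S (T (R f)) = f) \<and>
                  op_norm n R * op_norm N S \<le> (1 + \<eta>) / \<delta>)"
proof -
  define M :: nat where "M = 2 ^ Suc n"
  \<comment> \<open>The value for which the smallness condition of \<open>near_diagonal\<close>
    holds with equality.\<close>
  define \<theta> where "\<theta> = \<eta> / (1 + \<eta>) / ((real n + 1) * (2 ^ Suc n * (2 ^ n / \<delta>)))"
  \<comment> \<open>The number of levels in each window, large enough that the bound from
    \<open>exists_level\<close> falls below \<open>\<theta>\<close>.\<close>
  define m where "m = Suc (nat \<lceil>(2 * M * \<Gamma> / \<theta>)\<^sup>2\<rceil>)"
  define N where "N = M * m"
  have \<theta>: "\<theta> > 0" using assms by (simp add: \<theta>_def)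
  have \<theta>_eq: "(real n + 1) * (2 ^ Suc n * (\<theta> * 2 ^ n / \<delta>)) = \<eta> / (1 + \<eta>)"
  proof -
    have "(real n + 1) * (2 ^ Suc n * (\<theta> * 2 ^ n / \<delta>)) = \<theta> * ((real n + 1) * (2 ^ Suc n * (2 ^ n / \<delta>)))"
      by (simp add: mult_ac)
    then show ?thesis using assms by (simp add: \<theta>_def)
  qed
  have small: "2 * M * \<Gamma> / sqrt m \<le> \<theta>"
  proof -
    have "(2 * M * \<Gamma> / \<theta>)\<^sup>2 \<le> m" unfolding m_def by linarith
    then have "2 * M * \<Gamma> / \<theta> \<le> sqrt m" by (rule real_le_rsqrt)
    moreover have "sqrt m > 0"
      unfolding m_def real_sqrt_gt_0_iff of_nat_0_less_iff by simp
    ultimately show ?thesis using \<theta> by (simp add: field_simps)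
  qed
  show ?thesis
  proof (intro exI [of _ N] allI impI, elim conjE)
    fix T assume T: "is_operator N N T" "op_norm N T \<le> \<Gamma>"
      and T_diag: "\<forall>K\<in>dyadic_upto N. \<bar>pairing (T (haar K)) (haar K)\<bar> \<ge> \<delta> * measure lborel K"
    define c where "c K L = haar_coeff (T (haar (dyadic K))) L" for K L
    \<comment> \<open>The multiplier by \<open>s\<close> turns the diagonal entries of
      \<open>T\<close> into their absolute values, so the possibly varying signs of the diagonal
      disappear.\<close>
    define s where "s K = sgn (c K K)" for K
    define c' where "c' K L = c K L * s L" for K L
    have s: "\<bar>s K\<bar> \<le> 1" for K by (simp add: s_def abs_sgn_eq)
    have sum_c': "(\<Sum>K\<in>nodes N. a K * c' K L) = (\<Sum>K\<in>nodes N. a K * c K L) * s L" for a L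
      by (simp add: c'_def sum_distrib_right mult.assoc)
    have c'_bound: "norm_le N (\<lambda>L. \<Sum>K\<in>nodes N. a K * c' K L) \<Gamma>" if "norm_le N a 1" for a
      unfolding sum_c' using norm_le_SL_operator [OF T that] s by (intro norm_le_mult) (simp_all add: c_def)
    have c'_diag: "\<delta> \<le> c' K K" if "K \<in> nodes N" for K
    proof -
      have "\<delta> * node_length K \<le> \<bar>pairing (T (haar (dyadic K))) (haar (dyadic K))\<bar>"
        using T_diag that by (auto simp: dyadic_upto_eq measure_dyadic)
      also have "\<dots> = \<bar>c K K\<bar> * node_length K"
        using node_length_pos [of K] by (simp add: c_def haar_coeff_def)
      finally show ?thesis using node_length_pos [of K] by (simp add: c'_def s_def abs_sgn)
    qed
    obtain \<kappa> \<epsilon> where \<epsilon>: "\<And>i v. \<bar>\<epsilon> i v\<bar> = 1"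
      and \<kappa>: "\<And>i. i \<in> {1..<M} \<Longrightarrow> \<kappa> i \<in> {i * m..<Suc i * m}"
      and blocks_diag: "\<And>i. i \<in> {1..<M} \<Longrightarrow> \<delta> * (card (block_set (Suc N) \<kappa> \<epsilon> i) / 2 ^ \<kappa> i) \<le>
          bilinear N c' (block (Suc N) \<kappa> \<epsilon> i) (block (Suc N) \<kappa> \<epsilon> i)"
      and blocks_off: "\<And>i j. i \<in> {1..<M} \<Longrightarrow> j \<in> {1..<M} \<Longrightarrow> i \<noteq> j \<Longrightarrow>
          \<bar>bilinear N c' (block (Suc N) \<kappa> \<epsilon> i) (block (Suc N) \<kappa> \<epsilon> j)\<bar> \<le> \<theta>"
      using exists_blocks [OF c'_bound c'_diag N_def _ assms(1) small order_refl]
      unfolding m_def by blast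
    interpret block_tree N M \<kappa> \<epsilon>
    proof
      fix i j assume ij: "1 \<le> i" "i < j" "j < M"
      then have "Suc i * m \<le> j * m" by (intro mult_le_mono1) simp
      then show "\<kappa> i < \<kappa> j" using \<kappa> [of i] \<kappa> [of j] ij by simp
    next
      fix i assume i: "1 \<le> i" "i < M"
      then have "Suc i * m \<le> M * m" by (intro mult_le_mono1) simp
      then show "\<kappa> i \<le> N" using \<kappa> [of i] i by (simp add: N_def)
    qed (rule \<epsilon>)
    define A where "A i j = bilinear N c' (b i) (b j)" for i j
    interpret near_diagonal n A mass \<delta> \<eta> \<theta>
    proof
      fix j :: nat assume j: "j \<in> {1..<2 ^ Suc n}"
      obtain t where t: "t \<le> n" "j \<in> {2 ^ t..<2 ^ Suc t}" using exists_heap_level [OF j] .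
      then have "mass j = 1 / 2 ^ t" using j by (intro mass_level) (auto simp: M_def)
      then show "1 / 2 ^ n \<le> mass j" using t(1) by (simp add: frac_le power_increasing)
      show "\<delta> * mass j \<le> A j j"
        using blocks_diag [of j] card_B [of j] j by (simp add: A_def M_def)
    next
      fix i j :: nat assume "i \<in> {1..<2 ^ Suc n}" "j \<in> {1..<2 ^ Suc n}" "i \<noteq> j"
      then show "\<bar>A i j\<bar> \<le> \<theta>" using blocks_off unfolding A_def M_def by blast
    qed (use assms \<theta> \<theta>_eq in auto)
    define unheap where "unheap = inv_into (nodes n) heap_index"
    have unheap: "unheap (heap_index K) = K" if "K \<in> nodes n" for K
      unfolding unheap_def using that by (rule inv_into_f_f [OF inj_on_heap_index])
    have unheap_mem: "unheap i \<in> nodes n" if "i \<in> {1..<2 ^ Suc n}" for i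
      unfolding unheap_def using that by (intro inv_into_into) (simp only: heap_index_image)
    have heap_mem: "heap_index K \<in> {1..<2 ^ Suc n}" if "K \<in> nodes n" for K
      using that heap_index_image by blast
    define \<Phi> where "\<Phi> a = embed (\<lambda>i. a (unheap i))" for a :: "nat \<times> nat \<Rightarrow> real"
    \<comment> \<open>Coefficients pass through the multiplier, are averaged against the blocks, and
      then the inverse of the nearly diagonal system is applied.\<close>
    define \<Psi> where "\<Psi> g L = solution (average (\<lambda>K. g K * s K)) (heap_index L)" for g L
    define R where "R f = haar_sum N (\<Phi> (haar_coeff f))" for f
    define S where "S f = haar_sum n (\<Psi> (haar_coeff f))" for f
    have R: "is_operator n N R" "op_norm n R \<le> 1"
    proof -
      have add: "\<Phi> c L = \<Phi> a L + \<Phi> b L" if "\<And>K. K \<in> nodes n \<Longrightarrow> c K = a K + b K" for a b c L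
        unfolding \<Phi>_def embed_def unfolding M_def using that unheap_mem
        by (simp add: distrib_right sum.distrib del: power_Suc)
      have scale: "\<Phi> b L = r * \<Phi> a L" if "\<And>K. K \<in> nodes n \<Longrightarrow> b K = r * a K" for a b r L
        unfolding \<Phi>_def embed_def unfolding M_def using that unheap_mem
        by (simp add: sum_distrib_left mult.assoc del: power_Suc)
      have bound: "norm_le N (\<Phi> a) (1 * D)" if "0 \<le> D" "norm_le n a D" for a D
        unfolding norm_le_def \<Phi>_def
      proof (intro allI impI)
        fix w assume w: "w < (2::nat) ^ Suc N"
        have "norm_le n (\<lambda>K. a (unheap (heap_index K))) D"
          using that(2) by (subst norm_le_cong [of n _ a]) (simp_all add: unheap)
        \<comment> \<open>The path norm of the image on \<open>w\<close> is the tree norm at the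
          position \<open>branch w n\<close>, so no constant is lost.\<close>
        then show "path_norm N (embed (\<lambda>i. a (unheap i))) w \<le> 1 * D"
          using branch_level [of w n]
          unfolding norm_le_heap [of n "\<lambda>i. a (unheap i)"] path_norm_embed [OF M_def w] tree_norm_def by simp
      qed
      show "is_operator n N R" "op_norm n R \<le> 1"
        unfolding R_def [abs_def] by (rule is_operator_haar_sumI [where m = n and n = N and C = 1]; use add scale bound in auto)+
    qed
    have S: "is_operator N n S" "op_norm N S \<le> (1 + \<eta>) / \<delta>"
    proof -
      have add: "\<Psi> c L = \<Psi> a L + \<Psi> b L"
        if abc: "\<And>K. K \<in> nodes N \<Longrightarrow> c K = a K + b K" and L: "L \<in> nodes n" for a b c L
        unfolding \<Psi>_def
      \<comment> \<open>By uniqueness it suffices that the sum of the two solutions solves the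
        system for the summed averages.\<close>
      proof (rule solution_eqI [OF _ heap_mem [OF L]])
        fix j :: nat assume j: "j \<in> {1..<2 ^ Suc n}"
        have "average (\<lambda>K. c K * s K) j = average (\<lambda>K. a K * s K) j + average (\<lambda>K. b K * s K) j"
          unfolding average_def using abc
          by (simp add: distrib_right distrib_left sum.distrib add_divide_distrib)
        then show "(\<Sum>i\<in>{1..<2 ^ Suc n}. (solution (average (\<lambda>K. a K * s K)) i + solution (average (\<lambda>K. b K * s K)) i) * A i j) =
            average (\<lambda>K. c K * s K) j * mass j"
          using solution [OF j] by (simp only: distrib_right sum.distrib)
      qed
      have scale: "\<Psi> b L = r * \<Psi> a L"
        if ab: "\<And>K. K \<in> nodes N \<Longrightarrow> b K = r * a K" and L: "L \<in> nodes n" for a b r L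
        unfolding \<Psi>_def
      proof (rule solution_eqI [OF _ heap_mem [OF L]])
        fix j :: nat assume j: "j \<in> {1..<2 ^ Suc n}"
        have "average (\<lambda>K. b K * s K) j = r * average (\<lambda>K. a K * s K) j"
          unfolding average_def using ab by (simp add: sum_distrib_left mult_ac)
        then show "(\<Sum>i\<in>{1..<2 ^ Suc n}. (r * solution (average (\<lambda>K. a K * s K)) i) * A i j) =
            average (\<lambda>K. b K * s K) j * mass j"
          using solution [OF j] by (simp only: mult.assoc flip: sum_distrib_left)
      qed
      have bound: "norm_le n (\<Psi> g) ((1 + \<eta>) / \<delta> * D)" if "0 \<le> D" "norm_le N g D" for g D
        unfolding \<Psi>_def norm_le_heap
      proof
        fix J assume J: "J \<in> {2 ^ n..<(2::nat) ^ Suc n}"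
        show "tree_norm n (solution (average (\<lambda>K. g K * s K))) J \<le> (1 + \<eta>) / \<delta> * D"
        proof (rule solution_bound [OF solution _ J])
          fix I assume "I \<in> {2 ^ n..<(2::nat) ^ Suc n}"
          then show "tree_norm n (average (\<lambda>K. g K * s K)) I \<le> D"
            unfolding tree_norm_def using norm_le_mult [OF s that(2)] that(1)
            by (intro average_path_le) (auto simp: M_def)
        qed
      qed
      show "is_operator N n S" "op_norm N S \<le> (1 + \<eta>) / \<delta>"
        unfolding S_def [abs_def]
        by (rule is_operator_haar_sumI [where m = N and n = n and C = "(1 + \<eta>) / \<delta>"]; use add scale bound assms in auto)+
    qed
    have "S (T (R f)) = f" if f: "f \<in> SL n" for f
    proof -
      define \<alpha> where "\<alpha> i = haar_coeff f (unheap i)" for i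
      define g where "g L = (\<Sum>K\<in>nodes N. embed \<alpha> K * c K L)" for L
      have TR: "T (R f) = haar_sum N g"
        unfolding R_def \<Phi>_def operator_haar_sum [OF T(1)] by (simp add: g_def [abs_def] c_def \<alpha>_def [abs_def])
      \<comment> \<open>The averages of the multiplied image of \<open>R f\<close>, times the
        masses, are the numbers \<open>\<Sum> \<alpha> i * A i j\<close>. The coefficients
        \<open>\<alpha>\<close> of \<open>f\<close> thus solve the very system that \<open>S\<close>
        inverts.\<close>
      have "solution (average (\<lambda>K. haar_coeff (T (R f)) K * s K)) i = \<alpha> i" if i: "i \<in> {1..<2 ^ Suc n}" for i
      proof (rule solution_eqI [OF _ i])
        fix j :: nat assume j: "j \<in> {1..<2 ^ Suc n}"
        have gs: "g L * s L = (\<Sum>i\<in>{1..<M}. \<alpha> i * (\<Sum>K\<in>nodes N. b i K * c' K L))" for L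
        proof -
          have "g L * s L = (\<Sum>K\<in>nodes N. \<Sum>i\<in>{1..<M}. \<alpha> i * (b i K * c' K L))"
            by (simp add: g_def embed_def c'_def sum_distrib_right mult.assoc)
          also have "\<dots> = (\<Sum>i\<in>{1..<M}. \<Sum>K\<in>nodes N. \<alpha> i * (b i K * c' K L))"
            by (rule sum.swap)
          finally show ?thesis by (simp add: sum_distrib_left)
        qed
        have "average (\<lambda>K. haar_coeff (T (R f)) K * s K) j * mass j =
            (\<Sum>L\<in>nodes N. b j L * (g L * s L * node_length L))"
          using A_diag(1) [OF j] unfolding average_def TR by (simp add: haar_coeff_haar_sum)
        also have "\<dots> = (\<Sum>L\<in>nodes N. \<Sum>i\<in>{1..<M}. \<alpha> i * (b j L * ((\<Sum>K\<in>nodes N. b i K * c' K L) * node_length L)))"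
          unfolding gs sum_distrib_right sum_distrib_left by (simp add: mult_ac)
        also have "\<dots> = (\<Sum>i\<in>{1..<M}. \<Sum>L\<in>nodes N. \<alpha> i * (b j L * ((\<Sum>K\<in>nodes N. b i K * c' K L) * node_length L)))"
          by (rule sum.swap)
        also have "\<dots> = (\<Sum>i\<in>{1..<M}. \<alpha> i * A i j)"
          unfolding A_def bilinear_swap by (simp add: sum_distrib_left)
        finally show "(\<Sum>i\<in>{1..<2 ^ Suc n}. \<alpha> i * A i j) =
            average (\<lambda>K. haar_coeff (T (R f)) K * s K) j * mass j"
          by (simp add: M_def)
      qed
      then have "\<Psi> (haar_coeff (T (R f))) L = haar_coeff f L" if "L \<in> nodes n" for L
        using heap_mem [OF that] unheap [OF that] by (simp add: \<Psi>_def \<alpha>_def)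
      then have "S (T (R f)) = haar_sum n (haar_coeff f)" unfolding S_def by (rule haar_sum_cong)
      then show ?thesis using haar_sum_haar_coeff [OF f] by simp
    qed
    moreover have "op_norm n R * op_norm N S \<le> 1 * ((1 + \<eta>) / \<delta>)"
      using R S op_norm_nonneg by (intro mult_mono) auto
    ultimately show "\<exists>R S. is_operator n N R \<and> is_operator N n S \<and> (\<forall>f\<in>SL n. S (T (R f)) = f) \<and>
        op_norm n R * op_norm N S \<le> (1 + \<eta>) / \<delta>"
      using R(1) S(1) by auto
  qed
qed

end
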